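(* The sequence of simplicial sets $\mathrm{TW}(n)$, $n\ge0$, is a (nonsymmetric) $A_\infty$-operad of simplicial sets.
   Context: A nonsymmetric operad $\mathcal{O}$ of simplicial sets is an $A_\infty$-operad if every $\mathcal{O}(n)$, $n\ge 0$, is weakly contractible. For $k\ge0$, $\mathcal{B}_k$ is the strict monoidal category $(\mathcal{B}_k,\sqcup,())$ whose objects are finite words in $\{0,\dots,k\}$ (with $\sqcup$ = concatenation and unit the empty word $()$), freely generated as a strict monoidal category by morphisms $u^a\colon()\to(a)$, $m^a\colon(a,a)\to(a)$ for $0\le a\le k$, and $t^{a,b}\colon(a,b)\to(b,a)$ for $0\le b<a\le k$, subject to the relations $m^a\circ(\mathrm{id}_{(a)}\sqcup u^a)=\mathrm{id}_{(a)}=m^a\circ(u^a\sqcup\mathrm{id}_{(a)})$, and for $d<c$: $t^{c,d}\circ(\mathrm{id}_{(c)}\sqcup u^d)=u^d\sqcup\mathrm{id}_{(c)}$ and $t^{c,d}\circ(u^c\sqcup\mathrm{id}_{(d)})=\mathrm{id}_{(d)}\sqcup u^c$. The categories $\mathcal{B}_k$ form a simplicial strict monoidal category with the following strict monoidal functors. Face $d_i\colon\mathcal{B}_k\to\mathcal{B}_{k-1}$: put $\bar\jmath=j$ for $j<i$ and $\bar\jmath=j-1$ for $j>i$. Then $(i)\mapsto()$, $(j)\mapsto(\bar\jmath)$ for $j\neq i$; $u^i,m^i\mapsto\mathrm{id}_{()}$; $t^{i,d}\mapsto\mathrm{id}_{(\bar d)}$, $t^{c,i}\mapsto\mathrm{id}_{(\bar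 c)}$; generators not involving $i$ are relabelled by $j\mapsto\bar\jmath$. Degeneracy $s_i\colon\mathcal{B}_k\to\mathcal{B}_{k+1}$: put $\hat\jmath=j$ for $j<i$, $\hat\jmath=j+1$ for $j>i$, $i'=i$, $i''=i+1$. Then $(i)\mapsto(i',i'')$, $(j)\mapsto(\hat\jmath)$ for $j\ne i$; $u^i\mapsto u^{i'}\sqcup u^{i''}$; $m^i\mapsto(m^{i'}\sqcup m^{i''})\circ(\mathrm{id}_{(i')}\sqcup t^{i'',i'}\sqcup\mathrm{id}_{(i'')})$; $t^{i,d}\mapsto(t^{i',\hat d}\sqcup\mathrm{id}_{(i'')})\circ(\mathrm{id}_{(i')}\sqcup t^{i'',\hat d})$; $t^{c,i}\mapsto(\mathrm{id}_{(i')}\sqcup t^{\hat c,i''})\circ(t^{\hat c,i'}\sqcup\mathrm{id}_{(i'')})$; generators not involving $i$ are relabelled by $j\mapsto\hat\jmath$. Write $[k]$ for the object $(0,1,\dots,k)$ of $\mathcal{B}_k$ and $[k]^n$ for its $n$-fold concatenation. Then $\mathrm{TW}(n)_k=\mathrm{Hom}_{\mathcal{B}_k}([k]^n,[k])$, with simplicial structure induced by the $d_i,s_i$ (which carry $[k]^n$ to $[k-1]^n$, resp. $[k+1]^n$). The operad composition $\mathrm{TW}(n)\times\prod_{i=1}^n\mathrm{TW}(m_i)\to\mathrm{TW}(\sum_i m_i)$ is $(f;g_1,\dots,g_n)\mapsto f\circ(g_1\sqcup\cdots\sqcup g_n)$ and the unit is given by $\mathrm{id}_{[k]}$. *)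

theory Defs
  imports "HOL-Homology.Homology"
begin

section \<open>Simplicial sets\<close>

text \<open>
  \<open>face X k i\<close> is \<open>d_i : X_k \<rightarrow> X_{k-1}\<close> (relevant for \<open>k \<ge> 1\<close>, \<open>i \<le> k\<close>) and
  \<open>degen X k i\<close> is \<open>s_i : X_k \<rightarrow> X_{k+1}\<close> (relevant for \<open>i \<le> k\<close>); outside these ranges
  their values are irrelevant.
\<close>

record 'a sset =
  simplices :: "nat \<Rightarrow> 'a set"
  face :: "nat \<Rightarrow> nat \<Rightarrow> 'a \<Rightarrow> 'a"
  degen :: "nat \<Rightarrow> nat \<Rightarrow> 'a \<Rightarrow> 'a"

locale simplicial_set =
  fixes X :: "'a sset"
  assumes face_closed:
      "\<lbrakk>x \<in> simplices X (Suc k); i \<le> Suc k\<rbrakk> \<Longrightarrow> face X (Suc k) i x \<in> simplices X k"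
    and degen_closed:
      "\<lbrakk>x \<in> simplices X k; i \<le> k\<rbrakk> \<Longrightarrow> degen X k i x \<in> simplices X (Suc k)"
    and face_face:
      "\<lbrakk>x \<in> simplices X (Suc (Suc k)); i < j; j \<le> Suc (Suc k)\<rbrakk> \<Longrightarrow>
        face X (Suc k) i (face X (Suc (Suc k)) j x)
          = face X (Suc k) (j - 1) (face X (Suc (Suc k)) i x)"
    and face_degen_less:
      "\<lbrakk>x \<in> simplices X k; i < j; j \<le> k\<rbrakk> \<Longrightarrow>
        face X (Suc k) i (degen X k j x) = degen X (k - 1) (j - 1) (face X k i x)"
    and face_degen_same:
      "\<lbrakk>x \<in> simplices X k; j \<le> k\<rbrakk> \<Longrightarrow> face X (Suc k) j (degen X k j x) = x"
    and face_degen_Suc: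
      "\<lbrakk>x \<in> simplices X k; j \<le> k\<rbrakk> \<Longrightarrow> face X (Suc k) (Suc j) (degen X k j x) = x"
    and face_degen_greater:
      "\<lbrakk>x \<in> simplices X k; Suc j < i; i \<le> Suc k\<rbrakk> \<Longrightarrow>
        face X (Suc k) i (degen X k j x) = degen X (k - 1) j (face X k (i - 1) x)"
    and degen_degen:
      "\<lbrakk>x \<in> simplices X k; i \<le> j; j \<le> k\<rbrakk> \<Longrightarrow>
        degen X (Suc k) i (degen X k j x) = degen X (Suc k) (Suc j) (degen X k i x)"


section \<open>Geometric realization and weak contractibility\<close>

definition quotient_topology :: "'a topology \<Rightarrow> ('a \<Rightarrow> 'b) \<Rightarrow> 'b topology" where
  "quotient_topology X q =
    topology (\<lambda>U. U \<subseteq> q ` topspace X \<and> openin X {x \<in> topspace X. q x \<in> U})"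

lemma openin_quotient_topology:
  "openin (quotient_topology X q) U \<longleftrightarrow>
    U \<subseteq> q ` topspace X \<and> openin X {x \<in> topspace X. q x \<in> U}"
proof -
  have 1: "{x \<in> topspace X. q x \<in> S \<inter> T}
      = {x \<in> topspace X. q x \<in> S} \<inter> {x \<in> topspace X. q x \<in> T}" for S T
    by auto
  have 2: "{x \<in> topspace X. q x \<in> \<Union>\<K>} = (\<Union>K\<in>\<K>. {x \<in> topspace X. q x \<in> K})" for \<K>
    by auto
  have "istopology (\<lambda>U. U \<subseteq> q ` topspace X \<and> openin X {x \<in> topspace X. q x \<in> U})"
    unfolding istopology_def 1 2 by blast
  then show ?thesis
    by (simp add: quotient_topology_def)
qed

lemma topspace_quotient_topology: "topspace (quotient_topology X q) = q ` topspace X"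
proof (rule antisym)
  have "openin (quotient_topology X q) (topspace (quotient_topology X q))"
    by (rule openin_topspace)
  then show "topspace (quotient_topology X q) \<subseteq> q ` topspace X"
    by (simp only: openin_quotient_topology)
  have "{x \<in> topspace X. q x \<in> q ` topspace X} = topspace X"
    by auto
  then have "openin (quotient_topology X q) (q ` topspace X)"
    by (simp add: openin_quotient_topology)
  then show "q ` topspace X \<subseteq> topspace (quotient_topology X q)"
    by (rule openin_subset)
qed

lemma quotient_map_quotient_topology: "quotient_map X (quotient_topology X q) q"
  by (auto simp: quotient_map_def topspace_quotient_topology openin_quotient_topology)

text \<open>
  The coproduct of the spaces \<open>X_k \<times> \<Delta>\<^sup>k\<close>, with \<open>X_k\<close> discrete. Its points are
  \<open>((k, x), t)\<close> with \<open>x \<in> X_k\<close> and \<open>t \<in> \<Delta>\<^sup>k\<close> in barycentric coordinates.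
\<close>

definition cells :: "'a sset \<Rightarrow> ((nat \<times> 'a) \<times> (nat \<Rightarrow> real)) topology" where
  "cells X = sum_topology
     (\<lambda>(k, x). subtopology (powertop_real UNIV) (standard_simplex k))
     (Sigma UNIV (simplices X))"

text \<open>
  The coface map \<open>\<delta>\<^sup>i\<close> is the library's \<^const>\<open>simplical_face\<close>; the codegeneracy
  \<open>\<sigma>\<^sup>i\<close> adds the coordinates \<open>i\<close> and \<open>i + 1\<close>.
\<close>

definition simplical_degen :: "nat \<Rightarrow> (nat \<Rightarrow> real) \<Rightarrow> nat \<Rightarrow> real" where
  "simplical_degen i t =
    (\<lambda>j. if j < i then t j else if j = i then t i + t (Suc i) else t (Suc j))"

inductive glue ::
  "'a sset \<Rightarrow> (nat \<times> 'a) \<times> (nat \<Rightarrow> real) \<Rightarrow> (nat \<times> 'a) \<times> (nat \<Rightarrow> real) \<Rightarrow> bool"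
  for X where
  glue_face:
    "\<lbrakk>x \<in> simplices X (Suc k); i \<le> Suc k; t \<in> standard_simplex k\<rbrakk> \<Longrightarrow>
      glue X ((k, face X (Suc k) i x), t) ((Suc k, x), simplical_face i t)"
| glue_degen:
    "\<lbrakk>x \<in> simplices X k; i \<le> k; t \<in> standard_simplex (Suc k)\<rbrakk> \<Longrightarrow>
      glue X ((Suc k, degen X k i x), t) ((k, x), simplical_degen i t)"

definition realization :: "'a sset \<Rightarrow> ((nat \<times> 'a) \<times> (nat \<Rightarrow> real)) set topology" where
  "realization X = quotient_topology (cells X) (\<lambda>p. {q. equivclp (glue X) p q})"

text \<open>
  \<open>\<pi>_n(Y, y)\<close> is trivial: every pointed map \<open>(S\<^sup>n, e\<^sub>0) \<rightarrow> (Y, y)\<close> is homotopic, through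
  pointed maps, to the constant one. For \<open>n = 0\<close> this says that \<open>Y\<close> is path connected.
\<close>

definition trivial_homotopy_group :: "nat \<Rightarrow> 'b topology \<Rightarrow> 'b \<Rightarrow> bool" where
  "trivial_homotopy_group n Y y \<longleftrightarrow>
    (let e\<^sub>0 = (\<lambda>j::nat. if j = 0 then 1 else 0 :: real) in
      \<forall>f. continuous_map (nsphere n) Y f \<and> f e\<^sub>0 = y \<longrightarrow>
        homotopic_with (\<lambda>h. h e\<^sub>0 = y) (nsphere n) Y f (\<lambda>_. y))"

definition weakly_contractible_space :: "'b topology \<Rightarrow> bool" where
  "weakly_contractible_space Y \<longleftrightarrow>
    topspace Y \<noteq> {} \<and> (\<forall>n. \<forall>y \<in> topspace Y. trivial_homotopy_group n Y y)"

definition weakly_contractible :: "'a sset \<Rightarrow> bool" where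
  "weakly_contractible X \<longleftrightarrow> weakly_contractible_space (realization X)"


section \<open>Nonsymmetric operads of simplicial sets\<close>

text \<open>
  \<open>\<gamma> ms k f gs\<close> is the value at level \<open>k\<close> of the composition
  \<open>P(n) \<times> P(m_1) \<times> \<dots> \<times> P(m_n) \<rightarrow> P(m_1 + \<dots> + m_n)\<close>, where \<open>ms = [m_1, \<dots>, m_n]\<close> and
  \<open>gs\<close> is the list of the \<open>g_i \<in> P(m_i)_k\<close>; \<open>\<eta> k\<close> is the unit in \<open>P(1)_k\<close>.
\<close>

locale ns_operad =
  fixes P :: "nat \<Rightarrow> 'a sset"
    and \<gamma> :: "nat list \<Rightarrow> nat \<Rightarrow> 'a \<Rightarrow> 'a list \<Rightarrow> 'a"
    and \<eta> :: "nat \<Rightarrow> 'a"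
  assumes simplicial: "simplicial_set (P n)"
    and comp_closed:
      "\<lbrakk>f \<in> simplices (P (length ms)) k; list_all2 (\<lambda>m g. g \<in> simplices (P m) k) ms gs\<rbrakk> \<Longrightarrow>
        \<gamma> ms k f gs \<in> simplices (P (sum_list ms)) k"
    and comp_face:
      "\<lbrakk>f \<in> simplices (P (length ms)) (Suc k);
        list_all2 (\<lambda>m g. g \<in> simplices (P m) (Suc k)) ms gs; i \<le> Suc k\<rbrakk> \<Longrightarrow>
        face (P (sum_list ms)) (Suc k) i (\<gamma> ms (Suc k) f gs)
          = \<gamma> ms k (face (P (length ms)) (Suc k) i f)
              (map2 (\<lambda>m g. face (P m) (Suc k) i g) ms gs)"
    and comp_degen:
      "\<lbrakk>f \<in> simplices (P (length ms)) k;
        list_all2 (\<lambda>m g. g \<in> simplices (P m) k) ms gs; i \<le> k\<rbrakk> \<Longrightarrow>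
        degen (P (sum_list ms)) k i (\<gamma> ms k f gs)
          = \<gamma> ms (Suc k) (degen (P (length ms)) k i f)
              (map2 (\<lambda>m g. degen (P m) k i g) ms gs)"
    and unit_closed: "\<eta> k \<in> simplices (P 1) k"
    and unit_face: "i \<le> Suc k \<Longrightarrow> face (P 1) (Suc k) i (\<eta> (Suc k)) = \<eta> k"
    and unit_degen: "i \<le> k \<Longrightarrow> degen (P 1) k i (\<eta> k) = \<eta> (Suc k)"
    and unit_left: "f \<in> simplices (P n) k \<Longrightarrow> \<gamma> [n] k (\<eta> k) [f] = f"
    and unit_right:
      "f \<in> simplices (P n) k \<Longrightarrow> \<gamma> (replicate n 1) k f (replicate n (\<eta> k)) = f"
    and comp_assoc:
      "\<lbrakk>f \<in> simplices (P (length pss)) k;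
        list_all2 (\<lambda>ps g. g \<in> simplices (P (length ps)) k) pss gs;
        list_all2 (list_all2 (\<lambda>p h. h \<in> simplices (P p) k)) pss hss\<rbrakk> \<Longrightarrow>
        \<gamma> (concat pss) k (\<gamma> (map length pss) k f gs) (concat hss)
          = \<gamma> (map sum_list pss) k f
              (map (\<lambda>(ps, g, hs). \<gamma> ps k g hs) (zip pss (zip gs hss)))"

definition A_infinity_operad ::
  "(nat \<Rightarrow> 'a sset) \<Rightarrow> (nat list \<Rightarrow> nat \<Rightarrow> 'a \<Rightarrow> 'a list \<Rightarrow> 'a) \<Rightarrow> (nat \<Rightarrow> 'a) \<Rightarrow> bool" where
  "A_infinity_operad P \<gamma> \<eta> \<longleftrightarrow> ns_operad P \<gamma> \<eta> \<and> (\<forall>n. weakly_contractible (P n))"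


section \<open>The strict monoidal categories \<open>\<B>_k\<close>\<close>

text \<open>
  Morphisms of \<open>\<B>_k\<close> are formal terms in the generators, built with composition
  (\<open>f \<cdot> g\<close> is \<open>f\<close> after \<open>g\<close>) and monoidal product \<open>f \<parallel> g\<close>, modulo the smallest congruence
  \<open>bcong k\<close> containing the axioms of a strict monoidal category and the defining relations.
  \<open>TG c d\<close> denotes \<open>t\<^sup>c\<^sup>,\<^sup>d\<close>.
\<close>

type_synonym word = "nat list"

datatype bterm =
    IdG word
  | UG nat
  | MG nat
  | TG nat nat
  | Comp bterm bterm (infixr \<open>\<cdot>\<close> 70)
  | Tens bterm bterm (infixr \<open>\<parallel>\<close> 75)

primrec src :: "bterm \<Rightarrow> word" where
  "src (IdG w) = w"
| "src (UG a) = []"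
| "src (MG a) = [a, a]"
| "src (TG c d) = [c, d]"
| "src (f \<cdot> g) = src g"
| "src (f \<parallel> g) = src f @ src g"

primrec tgt :: "bterm \<Rightarrow> word" where
  "tgt (IdG w) = w"
| "tgt (UG a) = [a]"
| "tgt (MG a) = [a]"
| "tgt (TG c d) = [d, c]"
| "tgt (f \<cdot> g) = tgt f"
| "tgt (f \<parallel> g) = tgt f @ tgt g"

primrec wf_term :: "nat \<Rightarrow> bterm \<Rightarrow> bool" where
  "wf_term k (IdG w) \<longleftrightarrow> set w \<subseteq> {0..k}"
| "wf_term k (UG a) \<longleftrightarrow> a \<le> k"
| "wf_term k (MG a) \<longleftrightarrow> a \<le> k"
| "wf_term k (TG c d) \<longleftrightarrow> d < c \<and> c \<le> k"
| "wf_term k (f \<cdot> g) \<longleftrightarrow> wf_term k f \<and> wf_term k g \<and> src f = tgt g"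
| "wf_term k (f \<parallel> g) \<longleftrightarrow> wf_term k f \<and> wf_term k g"

inductive_set bcong :: "nat \<Rightarrow> (bterm \<times> bterm) set" for k where
  refl: "wf_term k f \<Longrightarrow> (f, f) \<in> bcong k"
| sym: "(f, g) \<in> bcong k \<Longrightarrow> (g, f) \<in> bcong k"
| trans: "\<lbrakk>(f, g) \<in> bcong k; (g, h) \<in> bcong k\<rbrakk> \<Longrightarrow> (f, h) \<in> bcong k"
| Comp_cong: "\<lbrakk>(f, f') \<in> bcong k; (g, g') \<in> bcong k; src f = tgt g\<rbrakk> \<Longrightarrow>
    (f \<cdot> g, f' \<cdot> g') \<in> bcong k"
| Tens_cong: "\<lbrakk>(f, f') \<in> bcong k; (g, g') \<in> bcong k\<rbrakk> \<Longrightarrow> (f \<parallel> g, f' \<parallel> g') \<in> bcong k"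
| Comp_assoc: "\<lbrakk>wf_term k f; wf_term k g; wf_term k h; src f = tgt g; src g = tgt h\<rbrakk> \<Longrightarrow>
    ((f \<cdot> g) \<cdot> h, f \<cdot> (g \<cdot> h)) \<in> bcong k"
| Id_left: "wf_term k f \<Longrightarrow> (IdG (tgt f) \<cdot> f, f) \<in> bcong k"
| Id_right: "wf_term k f \<Longrightarrow> (f \<cdot> IdG (src f), f) \<in> bcong k"
| Tens_assoc: "\<lbrakk>wf_term k f; wf_term k g; wf_term k h\<rbrakk> \<Longrightarrow>
    ((f \<parallel> g) \<parallel> h, f \<parallel> (g \<parallel> h)) \<in> bcong k"
| Tens_unit_left: "wf_term k f \<Longrightarrow> (IdG [] \<parallel> f, f) \<in> bcong k"
| Tens_unit_right: "wf_term k f \<Longrightarrow> (f \<parallel> IdG [], f) \<in> bcong k"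
| Tens_Id: "\<lbrakk>set v \<subseteq> {0..k}; set w \<subseteq> {0..k}\<rbrakk> \<Longrightarrow>
    (IdG v \<parallel> IdG w, IdG (v @ w)) \<in> bcong k"
| interchange: "\<lbrakk>wf_term k f; wf_term k f'; wf_term k g; wf_term k g';
      src f' = tgt f; src g' = tgt g\<rbrakk> \<Longrightarrow>
    ((f' \<parallel> g') \<cdot> (f \<parallel> g), (f' \<cdot> f) \<parallel> (g' \<cdot> g)) \<in> bcong k"
| mult_unit_right: "a \<le> k \<Longrightarrow> (MG a \<cdot> (IdG [a] \<parallel> UG a), IdG [a]) \<in> bcong k"
| mult_unit_left: "a \<le> k \<Longrightarrow> (MG a \<cdot> (UG a \<parallel> IdG [a]), IdG [a]) \<in> bcong k"
| swap_unit_right: "\<lbrakk>d < c; c \<le> k\<rbrakk> \<Longrightarrow>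
    (TG c d \<cdot> (IdG [c] \<parallel> UG d), UG d \<parallel> IdG [c]) \<in> bcong k"
| swap_unit_left: "\<lbrakk>d < c; c \<le> k\<rbrakk> \<Longrightarrow>
    (TG c d \<cdot> (UG c \<parallel> IdG [d]), IdG [d] \<parallel> UG c) \<in> bcong k"

lemma wf_term_words: "wf_term k f \<Longrightarrow> set (src f) \<subseteq> {0..k} \<and> set (tgt f) \<subseteq> {0..k}"
  by (induction f) auto

lemma bcong_typed:
  "(f, g) \<in> bcong k \<Longrightarrow> wf_term k f \<and> wf_term k g \<and> src f = src g \<and> tgt f = tgt g"
  by (induction rule: bcong.induct) (simp_all add: wf_term_words)

lemma equiv_bcong: "equiv {f. wf_term k f} (bcong k)"
proof (rule equivI)
  show "bcong k \<subseteq> {f. wf_term k f} \<times> {f. wf_term k f}"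
    by (auto dest: bcong_typed)
  show "refl_on {f. wf_term k f} (bcong k)"
    by (rule refl_onI) (simp add: bcong.refl)
  show "sym (bcong k)"
    by (rule symI) (rule bcong.sym)
  show "trans (bcong k)"
    by (rule transI) (rule bcong.trans)
qed

type_synonym bmor = "bterm set"

definition bmor_of :: "nat \<Rightarrow> bterm \<Rightarrow> bmor" where
  "bmor_of k f = bcong k `` {f}"

definition bhom :: "nat \<Rightarrow> word \<Rightarrow> word \<Rightarrow> bmor set" where
  "bhom k v w = {f. wf_term k f \<and> src f = v \<and> tgt f = w} // bcong k"

definition bcomp :: "nat \<Rightarrow> bmor \<Rightarrow> bmor \<Rightarrow> bmor" where
  "bcomp k F G = (\<Union>f\<in>F. \<Union>g\<in>G. bmor_of k (f \<cdot> g))"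

definition btens :: "nat \<Rightarrow> bmor \<Rightarrow> bmor \<Rightarrow> bmor" where
  "btens k F G = (\<Union>f\<in>F. \<Union>g\<in>G. bmor_of k (f \<parallel> g))"

definition bid :: "nat \<Rightarrow> word \<Rightarrow> bmor" where
  "bid k w = bmor_of k (IdG w)"

lemma bmor_of_eqI: "(f, g) \<in> bcong k \<Longrightarrow> bmor_of k f = bmor_of k g"
  unfolding bmor_of_def by (rule equiv_class_eq[OF equiv_bcong])

lemma bcomp_bmor_of:
  assumes "wf_term k f" "wf_term k g" "src f = tgt g"
  shows "bcomp k (bmor_of k f) (bmor_of k g) = bmor_of k (f \<cdot> g)"
proof -
  have eq: "bmor_of k (f' \<cdot> g') = bmor_of k (f \<cdot> g)"
    if "f' \<in> bmor_of k f" "g' \<in> bmor_of k g" for f' g'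
    using that bmor_of_eqI[OF bcong.Comp_cong[OF _ _ assms(3)]] by (simp add: bmor_of_def)
  have "f \<in> bmor_of k f" "g \<in> bmor_of k g"
    using assms by (simp_all add: bmor_of_def bcong.refl)
  with eq show ?thesis
    unfolding bcomp_def by blast
qed

lemma btens_bmor_of:
  assumes "wf_term k f" "wf_term k g"
  shows "btens k (bmor_of k f) (bmor_of k g) = bmor_of k (f \<parallel> g)"
proof -
  have eq: "bmor_of k (f' \<parallel> g') = bmor_of k (f \<parallel> g)"
    if "f' \<in> bmor_of k f" "g' \<in> bmor_of k g" for f' g'
    using that bmor_of_eqI[OF bcong.Tens_cong] by (simp add: bmor_of_def)
  have "f \<in> bmor_of k f" "g \<in> bmor_of k g"
    using assms by (simp_all add: bmor_of_def bcong.refl)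
  with eq show ?thesis
    unfolding btens_def by blast
qed


section \<open>The face and degeneracy functors\<close>

definition face_letter :: "nat \<Rightarrow> nat \<Rightarrow> nat" where
  "face_letter i j = (if j < i then j else j - 1)"

definition face_word :: "nat \<Rightarrow> word \<Rightarrow> word" where
  "face_word i w = map (face_letter i) (filter (\<lambda>j. j \<noteq> i) w)"

primrec face_term :: "nat \<Rightarrow> bterm \<Rightarrow> bterm" where
  "face_term i (IdG w) = IdG (face_word i w)"
| "face_term i (UG a) = (if a = i then IdG [] else UG (face_letter i a))"
| "face_term i (MG a) = (if a = i then IdG [] else MG (face_letter i a))"
| "face_term i (TG c d) =
    (if c = i then IdG [face_letter i d]
     else if d = i then IdG [face_letter i c]
     else TG (face_letter i c) (face_letter i d))"
| "face_term i (f \<cdot> g) = face_term i f \<cdot> face_term i g"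
| "face_term i (f \<parallel> g) = face_term i f \<parallel> face_term i g"

definition degen_letter :: "nat \<Rightarrow> nat \<Rightarrow> nat" where
  "degen_letter i j = (if j < i then j else Suc j)"

definition degen_word :: "nat \<Rightarrow> word \<Rightarrow> word" where
  "degen_word i w = concat (map (\<lambda>j. if j = i then [i, Suc i] else [degen_letter i j]) w)"

primrec degen_term :: "nat \<Rightarrow> bterm \<Rightarrow> bterm" where
  "degen_term i (IdG w) = IdG (degen_word i w)"
| "degen_term i (UG a) = (if a = i then UG i \<parallel> UG (Suc i) else UG (degen_letter i a))"
| "degen_term i (MG a) =
    (if a = i
     then (MG i \<parallel> MG (Suc i)) \<cdot> (IdG [i] \<parallel> TG (Suc i) i \<parallel> IdG [Suc i])
     else MG (degen_letter i a))"
| "degen_term i (TG c d) =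
    (if c = i
     then (TG i (degen_letter i d) \<parallel> IdG [Suc i]) \<cdot> (IdG [i] \<parallel> TG (Suc i) (degen_letter i d))
     else if d = i
     then (IdG [i] \<parallel> TG (degen_letter i c) (Suc i)) \<cdot> (TG (degen_letter i c) i \<parallel> IdG [Suc i])
     else TG (degen_letter i c) (degen_letter i d))"
| "degen_term i (f \<cdot> g) = degen_term i f \<cdot> degen_term i g"
| "degen_term i (f \<parallel> g) = degen_term i f \<parallel> degen_term i g"

text \<open>Induced maps on morphisms: \<open>bface k i\<close> maps \<open>\<B>_k\<close> to \<open>\<B>_{k-1}\<close>, \<open>bdegen k i\<close> maps \<open>\<B>_k\<close> to \<open>\<B>_{k+1}\<close>.\<close>

definition bface :: "nat \<Rightarrow> nat \<Rightarrow> bmor \<Rightarrow> bmor" where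
  "bface k i F = (\<Union>f\<in>F. bmor_of (k - 1) (face_term i f))"

definition bdegen :: "nat \<Rightarrow> nat \<Rightarrow> bmor \<Rightarrow> bmor" where
  "bdegen k i F = (\<Union>f\<in>F. bmor_of (Suc k) (degen_term i f))"

lemma face_word_simps [simp]:
  "face_word i [] = []"
  "face_word i (a # w) = (if a = i then face_word i w else face_letter i a # face_word i w)"
  "face_word i (v @ w) = face_word i v @ face_word i w"
  by (simp_all add: face_word_def)

lemma degen_word_simps [simp]:
  "degen_word i [] = []"
  "degen_word i (a # w) =
    (if a = i then i # Suc i # degen_word i w else degen_letter i a # degen_word i w)"
  "degen_word i (v @ w) = degen_word i v @ degen_word i w"
  by (simp_all add: degen_word_def)

lemma face_letter_le: "\<lbrakk>a \<le> Suc k; i \<le> Suc k; a \<noteq> i\<rbrakk> \<Longrightarrow> face_letter i a \<le> k"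
  by (auto simp: face_letter_def)

lemma face_letter_less: "\<lbrakk>d < c; c \<noteq> i; d \<noteq> i\<rbrakk> \<Longrightarrow> face_letter i d < face_letter i c"
  by (auto simp: face_letter_def)

lemma degen_letter_le: "\<lbrakk>a \<le> k\<rbrakk> \<Longrightarrow> degen_letter i a \<le> Suc k"
  by (auto simp: degen_letter_def)

lemma degen_letter_less: "d < c \<Longrightarrow> degen_letter i d < degen_letter i c"
  by (auto simp: degen_letter_def)

lemma degen_letter_below:
  "d < i \<Longrightarrow> degen_letter i d < i" "d < i \<Longrightarrow> degen_letter i d < Suc i"
  by (auto simp: degen_letter_def)

lemma degen_letter_above:
  "i < c \<Longrightarrow> Suc i < degen_letter i c" "i < c \<Longrightarrow> i < degen_letter i c"
  by (auto simp: degen_letter_def)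

lemma set_face_word: "\<lbrakk>set w \<subseteq> {0..Suc k}; i \<le> Suc k\<rbrakk> \<Longrightarrow> set (face_word i w) \<subseteq> {0..k}"
  by (induction w) (auto simp: face_letter_le)

lemma set_degen_word: "\<lbrakk>set w \<subseteq> {0..k}; i \<le> k\<rbrakk> \<Longrightarrow> set (degen_word i w) \<subseteq> {0..Suc k}"
  by (induction w) (auto simp: degen_letter_le)

lemma face_term_typed:
  assumes "i \<le> Suc k" "wf_term (Suc k) f"
  shows "wf_term k (face_term i f) \<and> src (face_term i f) = face_word i (src f)
    \<and> tgt (face_term i f) = face_word i (tgt f)"
  using assms(2)
proof (induction f)
  case (IdG w)
  then show ?case using set_face_word[OF _ assms(1)] by simp
next
  case (TG c d)
  then show ?case using assms(1) by (auto simp: face_letter_le face_letter_less)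
qed (use assms(1) in \<open>simp_all add: face_letter_le\<close>)

lemma degen_term_typed:
  assumes "i \<le> k" "wf_term k f"
  shows "wf_term (Suc k) (degen_term i f) \<and> src (degen_term i f) = degen_word i (src f)
    \<and> tgt (degen_term i f) = degen_word i (tgt f)"
  using assms(2)
proof (induction f)
  case (IdG w)
  then show ?case using set_degen_word[OF _ assms(1)] by simp
next
  case (TG c d)
  then show ?case
    using assms(1)
    by (auto simp: degen_letter_le degen_letter_less degen_letter_below degen_letter_above)
qed (use assms(1) in \<open>simp_all add: degen_letter_le\<close>)

lemma bcong_Tens_Comp:
  assumes "(f' \<cdot> f, h) \<in> bcong k" "(g' \<cdot> g, h') \<in> bcong k"
  shows "((f' \<parallel> g') \<cdot> (f \<parallel> g), h \<parallel> h') \<in> bcong k"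
proof -
  have "((f' \<parallel> g') \<cdot> (f \<parallel> g), (f' \<cdot> f) \<parallel> (g' \<cdot> g)) \<in> bcong k"
    using assms[THEN bcong_typed] by (intro bcong.interchange) simp_all
  then show ?thesis
    using bcong.Tens_cong[OF assms] by (rule bcong.trans)
qed

lemma bcong_Comp_right:
  assumes "(s, s') \<in> bcong k" "(g \<cdot> s', r) \<in> bcong k"
  shows "(g \<cdot> s, r) \<in> bcong k"
proof -
  have "(g \<cdot> s, g \<cdot> s') \<in> bcong k"
    using assms[THEN bcong_typed] by (intro bcong.Comp_cong assms bcong.refl) simp_all
  then show ?thesis
    using assms(2) by (rule bcong.trans)
qed

lemma bcong_Comp_Comp:
  assumes "(g \<cdot> s, s') \<in> bcong k" "(f \<cdot> s', r) \<in> bcong k"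
  shows "((f \<cdot> g) \<cdot> s, r) \<in> bcong k"
proof -
  have "((f \<cdot> g) \<cdot> s, f \<cdot> (g \<cdot> s)) \<in> bcong k"
    using assms[THEN bcong_typed] by (intro bcong.Comp_assoc) simp_all
  then show ?thesis
    using bcong_Comp_right[OF assms] by (rule bcong.trans)
qed

lemma bcong_Id_left: "\<lbrakk>wf_term k f; tgt f = w\<rbrakk> \<Longrightarrow> (IdG w \<cdot> f, f) \<in> bcong k"
  using bcong.Id_left by blast

lemma bcong_Id_two: "\<lbrakk>a \<le> k; b \<le> k\<rbrakk> \<Longrightarrow> (IdG [a, b], IdG [a] \<parallel> IdG [b]) \<in> bcong k"
  using bcong.sym[OF bcong.Tens_Id[of "[a]" k "[b]"]] by simp

lemma bcong_Tens_assoc':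
  "\<lbrakk>wf_term k f; wf_term k g; wf_term k h\<rbrakk> \<Longrightarrow> (f \<parallel> (g \<parallel> h), (f \<parallel> g) \<parallel> h) \<in> bcong k"
  by (rule bcong.sym) (rule bcong.Tens_assoc)

text \<open>The maps on terms respect the defining relations, so they induce maps of morphisms.\<close>

lemma face_term_bcong:
  assumes "(f, g) \<in> bcong (Suc k)" "i \<le> Suc k"
  shows "(face_term i f, face_term i g) \<in> bcong k"
  using assms(1)
proof (induction rule: bcong.induct)
  case (sym f g)
  from sym.IH show ?case by (rule bcong.sym)
next
  case (trans f g h)
  from trans.IH show ?case by (rule bcong.trans)
next
  case (Comp_cong f f' g g')
  from Comp_cong.hyps(1,2)[THEN bcong_typed] Comp_cong.IH Comp_cong.hyps show ?case
    by (simp add: bcong.Comp_cong face_term_typed[OF assms(2)])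
next
  case (mult_unit_right a)
  show ?case
  proof (cases "a = i")
    case True
    have "(IdG [] \<cdot> (IdG [] \<parallel> IdG []), IdG []) \<in> bcong k"
      by (rule bcong_Comp_right[OF bcong.Tens_unit_left bcong_Id_left]) simp_all
    then show ?thesis using True by simp
  qed (use mult_unit_right assms(2) in \<open>simp add: bcong.mult_unit_right face_letter_le\<close>)
next
  case (mult_unit_left a)
  show ?case
  proof (cases "a = i")
    case True
    have "(IdG [] \<cdot> (IdG [] \<parallel> IdG []), IdG []) \<in> bcong k"
      by (rule bcong_Comp_right[OF bcong.Tens_unit_left bcong_Id_left]) simp_all
    then show ?thesis using True by simp
  qed (use mult_unit_left assms(2) in \<open>simp add: bcong.mult_unit_left face_letter_le\<close>)
next
  case (swap_unit_right d c)
  consider "c = i" | "d = i" "c \<noteq> i" | "c \<noteq> i" "d \<noteq> i" by blast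
  then show ?case
  proof cases
    case 1
    let ?d = "face_letter i d"
    have d: "?d \<le> k" using swap_unit_right 1 assms(2) by (simp add: face_letter_le)
    have "(IdG [?d] \<cdot> (IdG [] \<parallel> UG ?d), UG ?d) \<in> bcong k"
      by (rule bcong_Comp_right[OF bcong.Tens_unit_left bcong_Id_left]) (simp_all add: d)
    moreover have "(UG ?d, UG ?d \<parallel> IdG []) \<in> bcong k"
      by (rule bcong.sym[OF bcong.Tens_unit_right]) (simp add: d)
    ultimately have "(IdG [?d] \<cdot> (IdG [] \<parallel> UG ?d), UG ?d \<parallel> IdG []) \<in> bcong k" by (rule bcong.trans)
    then show ?thesis using 1 swap_unit_right by simp
  next
    case 2
    let ?c = "face_letter i c"
    have c: "?c \<le> k" using swap_unit_right 2 assms(2) by (simp add: face_letter_le)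
    have "(IdG [?c] \<cdot> (IdG [?c] \<parallel> IdG []), IdG [?c]) \<in> bcong k"
      by (rule bcong_Comp_right[OF bcong.Tens_unit_right bcong_Id_left]) (simp_all add: c)
    moreover have "(IdG [?c], IdG [] \<parallel> IdG [?c]) \<in> bcong k"
      by (rule bcong.sym[OF bcong.Tens_unit_left]) (simp add: c)
    ultimately have "(IdG [?c] \<cdot> (IdG [?c] \<parallel> IdG []), IdG [] \<parallel> IdG [?c]) \<in> bcong k" by (rule bcong.trans)
    then show ?thesis using 2 swap_unit_right by simp
  qed (use swap_unit_right assms(2) in
      \<open>simp add: bcong.swap_unit_right face_letter_le face_letter_less\<close>)
next
  case (swap_unit_left d c)
  consider "c = i" | "d = i" "c \<noteq> i" | "c \<noteq> i" "d \<noteq> i" by blast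
  then show ?case
  proof cases
    case 1
    let ?d = "face_letter i d"
    have d: "?d \<le> k" using swap_unit_left 1 assms(2) by (simp add: face_letter_le)
    have "(IdG [?d] \<cdot> (IdG [] \<parallel> IdG [?d]), IdG [?d]) \<in> bcong k"
      by (rule bcong_Comp_right[OF bcong.Tens_unit_left bcong_Id_left]) (simp_all add: d)
    moreover have "(IdG [?d], IdG [?d] \<parallel> IdG []) \<in> bcong k"
      by (rule bcong.sym[OF bcong.Tens_unit_right]) (simp add: d)
    ultimately have "(IdG [?d] \<cdot> (IdG [] \<parallel> IdG [?d]), IdG [?d] \<parallel> IdG []) \<in> bcong k" by (rule bcong.trans)
    then show ?thesis using 1 swap_unit_left by simp
  next
    case 2
    let ?c = "face_letter i c"
    have c: "?c \<le> k" using swap_unit_left 2 assms(2) by (simp add: face_letter_le)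
    have "(IdG [?c] \<cdot> (UG ?c \<parallel> IdG []), UG ?c) \<in> bcong k"
      by (rule bcong_Comp_right[OF bcong.Tens_unit_right bcong_Id_left]) (simp_all add: c)
    moreover have "(UG ?c, IdG [] \<parallel> UG ?c) \<in> bcong k"
      by (rule bcong.sym[OF bcong.Tens_unit_left]) (simp add: c)
    ultimately have "(IdG [?c] \<cdot> (UG ?c \<parallel> IdG []), IdG [] \<parallel> UG ?c) \<in> bcong k" by (rule bcong.trans)
    then show ?thesis using 2 swap_unit_left by simp
  qed (use swap_unit_left assms(2) in
      \<open>simp add: bcong.swap_unit_left face_letter_le face_letter_less\<close>)
next
  case (Id_left f)
  then show ?case using assms(2) face_term_typed[of i k f] by (simp add: bcong_Id_left)
next
  case (Id_right f)
  then show ?case using assms(2) face_term_typed[of i k f] bcong.Id_right[of k "face_term i f"] by simp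
next
  case (Tens_Id v w)
  then show ?case using assms(2) set_face_word by (simp add: bcong.Tens_Id)
qed (simp_all add: face_term_typed[OF assms(2)] bcong.refl bcong.Tens_cong bcong.Comp_assoc bcong.Tens_assoc
      bcong.Tens_unit_left bcong.Tens_unit_right bcong.interchange)

lemma degen_mult_unit:
  assumes "Suc i \<le> k"
  defines "D \<equiv> degen_term i (MG i)"
  shows "(D \<cdot> (IdG [i, Suc i] \<parallel> (UG i \<parallel> UG (Suc i))), IdG [i, Suc i]) \<in> bcong k"
    and "(D \<cdot> ((UG i \<parallel> UG (Suc i)) \<parallel> IdG [i, Suc i]), IdG [i, Suc i]) \<in> bcong k"
proof -
  let ?x = "i" and ?y = "Suc i"
  let ?I = "\<lambda>a. IdG [a]"
  note wf = assms(1)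
  have D: "D = (MG ?x \<parallel> MG ?y) \<cdot> (?I ?x \<parallel> TG ?y ?x \<parallel> ?I ?y)"
    by (simp add: D_def)
  have Id2: "(?I ?x \<parallel> ?I ?y, IdG [?x, ?y]) \<in> bcong k"
    by (rule bcong.sym[OF bcong_Id_two]) (use wf in simp_all)
  have outer: "((MG ?x \<parallel> MG ?y) \<cdot> (p \<parallel> q), IdG [?x, ?y]) \<in> bcong k"
    if "(MG ?x \<cdot> p, ?I ?x) \<in> bcong k" "(MG ?y \<cdot> q, ?I ?y) \<in> bcong k" for p q
    using bcong_Tens_Comp[OF that] Id2 by (rule bcong.trans)
  have s1: "(IdG [?x, ?y] \<parallel> (UG ?x \<parallel> UG ?y), ?I ?x \<parallel> ((?I ?y \<parallel> UG ?x) \<parallel> UG ?y)) \<in> bcong k"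
  proof -
    have "(IdG [?x, ?y] \<parallel> (UG ?x \<parallel> UG ?y), (?I ?x \<parallel> ?I ?y) \<parallel> (UG ?x \<parallel> UG ?y)) \<in> bcong k"
      by (rule bcong.Tens_cong[OF bcong.sym[OF Id2] bcong.refl]) (use wf in simp)
    moreover have "((?I ?x \<parallel> ?I ?y) \<parallel> (UG ?x \<parallel> UG ?y), ?I ?x \<parallel> (?I ?y \<parallel> (UG ?x \<parallel> UG ?y))) \<in> bcong k"
      by (rule bcong.Tens_assoc) (use wf in simp_all)
    moreover have "(?I ?x \<parallel> (?I ?y \<parallel> (UG ?x \<parallel> UG ?y)), ?I ?x \<parallel> ((?I ?y \<parallel> UG ?x) \<parallel> UG ?y)) \<in> bcong k"
      by (rule bcong.Tens_cong[OF bcong.refl bcong_Tens_assoc']) (use wf in simp_all)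
    ultimately show ?thesis by (metis bcong.trans)
  qed
  have s2: "((?I ?x \<parallel> TG ?y ?x \<parallel> ?I ?y) \<cdot> (?I ?x \<parallel> ((?I ?y \<parallel> UG ?x) \<parallel> UG ?y)),
      ?I ?x \<parallel> ((UG ?x \<parallel> ?I ?y) \<parallel> UG ?y)) \<in> bcong k"
    by (rule bcong_Tens_Comp[OF bcong_Id_left
          bcong_Tens_Comp[OF bcong.swap_unit_right bcong_Id_left]]) (use wf in simp_all)
  have s3: "(?I ?x \<parallel> ((UG ?x \<parallel> ?I ?y) \<parallel> UG ?y), (?I ?x \<parallel> UG ?x) \<parallel> (?I ?y \<parallel> UG ?y)) \<in> bcong k"
  proof -
    have "(?I ?x \<parallel> ((UG ?x \<parallel> ?I ?y) \<parallel> UG ?y), ?I ?x \<parallel> (UG ?x \<parallel> (?I ?y \<parallel> UG ?y))) \<in> bcong k"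
      by (rule bcong.Tens_cong[OF bcong.refl bcong.Tens_assoc]) (use wf in simp_all)
    moreover have "(?I ?x \<parallel> (UG ?x \<parallel> (?I ?y \<parallel> UG ?y)), (?I ?x \<parallel> UG ?x) \<parallel> (?I ?y \<parallel> UG ?y)) \<in> bcong k"
      by (rule bcong_Tens_assoc') (use wf in simp_all)
    ultimately show ?thesis by (rule bcong.trans)
  qed
  show "(D \<cdot> (IdG [i, Suc i] \<parallel> (UG i \<parallel> UG (Suc i))), IdG [i, Suc i]) \<in> bcong k"
    unfolding D
    by (rule bcong_Comp_Comp[OF bcong_Comp_right[OF s1 s2]
          bcong_Comp_right[OF s3 outer[OF bcong.mult_unit_right bcong.mult_unit_right]]])
      (use wf in simp_all)
  have r1: "((UG ?x \<parallel> UG ?y) \<parallel> IdG [?x, ?y], UG ?x \<parallel> ((UG ?y \<parallel> ?I ?x) \<parallel> ?I ?y)) \<in> bcong k"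
  proof -
    have "((UG ?x \<parallel> UG ?y) \<parallel> IdG [?x, ?y], (UG ?x \<parallel> UG ?y) \<parallel> (?I ?x \<parallel> ?I ?y)) \<in> bcong k"
      by (rule bcong.Tens_cong[OF bcong.refl bcong.sym[OF Id2]]) (use wf in simp)
    moreover have "((UG ?x \<parallel> UG ?y) \<parallel> (?I ?x \<parallel> ?I ?y), UG ?x \<parallel> (UG ?y \<parallel> (?I ?x \<parallel> ?I ?y))) \<in> bcong k"
      by (rule bcong.Tens_assoc) (use wf in simp_all)
    moreover have "(UG ?x \<parallel> (UG ?y \<parallel> (?I ?x \<parallel> ?I ?y)), UG ?x \<parallel> ((UG ?y \<parallel> ?I ?x) \<parallel> ?I ?y)) \<in> bcong k"
      by (rule bcong.Tens_cong[OF bcong.refl bcong_Tens_assoc']) (use wf in simp_all)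
    ultimately show ?thesis by (metis bcong.trans)
  qed
  have r2: "((?I ?x \<parallel> TG ?y ?x \<parallel> ?I ?y) \<cdot> (UG ?x \<parallel> ((UG ?y \<parallel> ?I ?x) \<parallel> ?I ?y)),
      UG ?x \<parallel> ((?I ?x \<parallel> UG ?y) \<parallel> ?I ?y)) \<in> bcong k"
    by (rule bcong_Tens_Comp[OF bcong_Id_left
          bcong_Tens_Comp[OF bcong.swap_unit_left bcong_Id_left]]) (use wf in simp_all)
  have r3: "(UG ?x \<parallel> ((?I ?x \<parallel> UG ?y) \<parallel> ?I ?y), (UG ?x \<parallel> ?I ?x) \<parallel> (UG ?y \<parallel> ?I ?y)) \<in> bcong k"
  proof -
    have "(UG ?x \<parallel> ((?I ?x \<parallel> UG ?y) \<parallel> ?I ?y), UG ?x \<parallel> (?I ?x \<parallel> (UG ?y \<parallel> ?I ?y))) \<in> bcong k"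
      by (rule bcong.Tens_cong[OF bcong.refl bcong.Tens_assoc]) (use wf in simp_all)
    moreover have "(UG ?x \<parallel> (?I ?x \<parallel> (UG ?y \<parallel> ?I ?y)), (UG ?x \<parallel> ?I ?x) \<parallel> (UG ?y \<parallel> ?I ?y)) \<in> bcong k"
      by (rule bcong_Tens_assoc') (use wf in simp_all)
    ultimately show ?thesis by (rule bcong.trans)
  qed
  show "(D \<cdot> ((UG i \<parallel> UG (Suc i)) \<parallel> IdG [i, Suc i]), IdG [i, Suc i]) \<in> bcong k"
    unfolding D
    by (rule bcong_Comp_Comp[OF bcong_Comp_right[OF r1 r2]
          bcong_Comp_right[OF r3 outer[OF bcong.mult_unit_left bcong.mult_unit_left]]])
      (use wf in simp_all)
qed

lemma degen_swap_unit_upper: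
  assumes "d < i" "Suc i \<le> k"
  defines "D \<equiv> (TG i d \<parallel> IdG [Suc i]) \<cdot> (IdG [i] \<parallel> TG (Suc i) d)"
  shows "(D \<cdot> (IdG [i, Suc i] \<parallel> UG d), UG d \<parallel> IdG [i, Suc i]) \<in> bcong k"
    and "(D \<cdot> ((UG i \<parallel> UG (Suc i)) \<parallel> IdG [d]), IdG [d] \<parallel> (UG i \<parallel> UG (Suc i))) \<in> bcong k"
proof -
  let ?x = "i" and ?y = "Suc i"
  let ?I = "\<lambda>a. IdG [a]"
  note wf = assms(1,2)
  have Id2: "(?I ?x \<parallel> ?I ?y, IdG [?x, ?y]) \<in> bcong k"
    by (rule bcong.sym[OF bcong_Id_two]) (use wf in simp_all)
  have s1: "(IdG [?x, ?y] \<parallel> UG d, ?I ?x \<parallel> (?I ?y \<parallel> UG d)) \<in> bcong k"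
    by (rule bcong.trans[OF bcong.Tens_cong[OF bcong.sym[OF Id2] bcong.refl] bcong.Tens_assoc])
      (use wf in simp_all)
  have s2: "((?I ?x \<parallel> TG ?y d) \<cdot> (?I ?x \<parallel> (?I ?y \<parallel> UG d)), ?I ?x \<parallel> (UG d \<parallel> ?I ?y)) \<in> bcong k"
    by (rule bcong_Tens_Comp[OF bcong_Id_left bcong.swap_unit_right]) (use wf in simp_all)
  have s3: "(?I ?x \<parallel> (UG d \<parallel> ?I ?y), (?I ?x \<parallel> UG d) \<parallel> ?I ?y) \<in> bcong k"
    by (rule bcong_Tens_assoc') (use wf in simp_all)
  have s4: "((TG ?x d \<parallel> ?I ?y) \<cdot> ((?I ?x \<parallel> UG d) \<parallel> ?I ?y), (UG d \<parallel> ?I ?x) \<parallel> ?I ?y) \<in> bcong k"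
    by (rule bcong_Tens_Comp[OF bcong.swap_unit_right bcong_Id_left]) (use wf in simp_all)
  have s5: "((UG d \<parallel> ?I ?x) \<parallel> ?I ?y, UG d \<parallel> IdG [?x, ?y]) \<in> bcong k"
    by (rule bcong.trans[OF bcong.Tens_assoc bcong.Tens_cong[OF bcong.refl Id2]])
      (use wf in simp_all)
  show "(D \<cdot> (IdG [i, Suc i] \<parallel> UG d), UG d \<parallel> IdG [i, Suc i]) \<in> bcong k"
    unfolding D_def
    by (rule bcong_Comp_Comp[OF bcong_Comp_right[OF s1 s2]
          bcong_Comp_right[OF s3 bcong.trans[OF s4 s5]]])
  have r1: "((UG ?x \<parallel> UG ?y) \<parallel> ?I d, UG ?x \<parallel> (UG ?y \<parallel> ?I d)) \<in> bcong k"
    by (rule bcong.Tens_assoc) (use wf in simp_all)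
  have r2: "((?I ?x \<parallel> TG ?y d) \<cdot> (UG ?x \<parallel> (UG ?y \<parallel> ?I d)), UG ?x \<parallel> (?I d \<parallel> UG ?y)) \<in> bcong k"
    by (rule bcong_Tens_Comp[OF bcong_Id_left bcong.swap_unit_left]) (use wf in simp_all)
  have r3: "(UG ?x \<parallel> (?I d \<parallel> UG ?y), (UG ?x \<parallel> ?I d) \<parallel> UG ?y) \<in> bcong k"
    by (rule bcong_Tens_assoc') (use wf in simp_all)
  have r4: "((TG ?x d \<parallel> ?I ?y) \<cdot> ((UG ?x \<parallel> ?I d) \<parallel> UG ?y), (?I d \<parallel> UG ?x) \<parallel> UG ?y) \<in> bcong k"
    by (rule bcong_Tens_Comp[OF bcong.swap_unit_left bcong_Id_left]) (use wf in simp_all)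
  have r5: "((?I d \<parallel> UG ?x) \<parallel> UG ?y, ?I d \<parallel> (UG ?x \<parallel> UG ?y)) \<in> bcong k"
    by (rule bcong.Tens_assoc) (use wf in simp_all)
  show "(D \<cdot> ((UG i \<parallel> UG (Suc i)) \<parallel> IdG [d]), IdG [d] \<parallel> (UG i \<parallel> UG (Suc i))) \<in> bcong k"
    unfolding D_def
    by (rule bcong_Comp_Comp[OF bcong_Comp_right[OF r1 r2]
          bcong_Comp_right[OF r3 bcong.trans[OF r4 r5]]])
qed

lemma degen_swap_unit_lower:
  assumes "Suc i < c" "c \<le> k"
  defines "D \<equiv> (IdG [i] \<parallel> TG c (Suc i)) \<cdot> (TG c i \<parallel> IdG [Suc i])"
  shows "(D \<cdot> (IdG [c] \<parallel> (UG i \<parallel> UG (Suc i))), (UG i \<parallel> UG (Suc i)) \<parallel> IdG [c]) \<in> bcong k"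
    and "(D \<cdot> (UG c \<parallel> IdG [i, Suc i]), IdG [i, Suc i] \<parallel> UG c) \<in> bcong k"
proof -
  let ?x = "i" and ?y = "Suc i"
  let ?I = "\<lambda>a. IdG [a]"
  note wf = assms(1,2)
  have Id2: "(?I ?x \<parallel> ?I ?y, IdG [?x, ?y]) \<in> bcong k"
    by (rule bcong.sym[OF bcong_Id_two]) (use wf in simp_all)
  have s1: "(?I c \<parallel> (UG ?x \<parallel> UG ?y), (?I c \<parallel> UG ?x) \<parallel> UG ?y) \<in> bcong k"
    by (rule bcong_Tens_assoc') (use wf in simp_all)
  have s2: "((TG c ?x \<parallel> ?I ?y) \<cdot> ((?I c \<parallel> UG ?x) \<parallel> UG ?y), (UG ?x \<parallel> ?I c) \<parallel> UG ?y) \<in> bcong k"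
    by (rule bcong_Tens_Comp[OF bcong.swap_unit_right bcong_Id_left]) (use wf in simp_all)
  have s3: "((UG ?x \<parallel> ?I c) \<parallel> UG ?y, UG ?x \<parallel> (?I c \<parallel> UG ?y)) \<in> bcong k"
    by (rule bcong.Tens_assoc) (use wf in simp_all)
  have s4: "((?I ?x \<parallel> TG c ?y) \<cdot> (UG ?x \<parallel> (?I c \<parallel> UG ?y)), UG ?x \<parallel> (UG ?y \<parallel> ?I c)) \<in> bcong k"
    by (rule bcong_Tens_Comp[OF bcong_Id_left bcong.swap_unit_right]) (use wf in simp_all)
  have s5: "(UG ?x \<parallel> (UG ?y \<parallel> ?I c), (UG ?x \<parallel> UG ?y) \<parallel> ?I c) \<in> bcong k"
    by (rule bcong_Tens_assoc') (use wf in simp_all)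
  show "(D \<cdot> (IdG [c] \<parallel> (UG i \<parallel> UG (Suc i))), (UG i \<parallel> UG (Suc i)) \<parallel> IdG [c]) \<in> bcong k"
    unfolding D_def
    by (rule bcong_Comp_Comp[OF bcong_Comp_right[OF s1 s2]
          bcong_Comp_right[OF s3 bcong.trans[OF s4 s5]]])
  have r1: "(UG c \<parallel> IdG [?x, ?y], (UG c \<parallel> ?I ?x) \<parallel> ?I ?y) \<in> bcong k"
    by (rule bcong.trans[OF bcong.Tens_cong[OF bcong.refl bcong.sym[OF Id2]] bcong_Tens_assoc'])
      (use wf in simp_all)
  have r2: "((TG c ?x \<parallel> ?I ?y) \<cdot> ((UG c \<parallel> ?I ?x) \<parallel> ?I ?y), (?I ?x \<parallel> UG c) \<parallel> ?I ?y) \<in> bcong k"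
    by (rule bcong_Tens_Comp[OF bcong.swap_unit_left bcong_Id_left]) (use wf in simp_all)
  have r3: "((?I ?x \<parallel> UG c) \<parallel> ?I ?y, ?I ?x \<parallel> (UG c \<parallel> ?I ?y)) \<in> bcong k"
    by (rule bcong.Tens_assoc) (use wf in simp_all)
  have r4: "((?I ?x \<parallel> TG c ?y) \<cdot> (?I ?x \<parallel> (UG c \<parallel> ?I ?y)), ?I ?x \<parallel> (?I ?y \<parallel> UG c)) \<in> bcong k"
    by (rule bcong_Tens_Comp[OF bcong_Id_left bcong.swap_unit_left]) (use wf in simp_all)
  have r5: "(?I ?x \<parallel> (?I ?y \<parallel> UG c), IdG [?x, ?y] \<parallel> UG c) \<in> bcong k"
    by (rule bcong.trans[OF bcong_Tens_assoc' bcong.Tens_cong[OF Id2 bcong.refl]])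
      (use wf in simp_all)
  show "(D \<cdot> (UG c \<parallel> IdG [i, Suc i]), IdG [i, Suc i] \<parallel> UG c) \<in> bcong k"
    unfolding D_def
    by (rule bcong_Comp_Comp[OF bcong_Comp_right[OF r1 r2]
          bcong_Comp_right[OF r3 bcong.trans[OF r4 r5]]])
qed

lemma degen_term_bcong:
  assumes "(f, g) \<in> bcong k" "i \<le> k"
  shows "(degen_term i f, degen_term i g) \<in> bcong (Suc k)"
  using assms(1)
proof (induction rule: bcong.induct)
  case (sym f g)
  from sym.IH show ?case by (rule bcong.sym)
next
  case (trans f g h)
  from trans.IH show ?case by (rule bcong.trans)
next
  case (Comp_cong f f' g g')
  from Comp_cong.hyps(1,2)[THEN bcong_typed] Comp_cong.IH Comp_cong.hyps show ?case
    by (simp add: bcong.Comp_cong degen_term_typed[OF assms(2)])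
next
  case (mult_unit_right a)
  then show ?case
    using assms(2) degen_mult_unit(1)[of i "Suc k"]
    by (cases "a = i") (simp_all add: bcong.mult_unit_right degen_letter_le)
next
  case (mult_unit_left a)
  then show ?case
    using assms(2) degen_mult_unit(2)[of i "Suc k"]
    by (cases "a = i") (simp_all add: bcong.mult_unit_left degen_letter_le)
next
  case (swap_unit_right d c)
  consider "c = i" | "d = i" "c \<noteq> i" | "c \<noteq> i" "d \<noteq> i" by blast
  then show ?case
  proof cases
    case 1
    then show ?thesis
      using swap_unit_right assms(2) degen_swap_unit_upper(1)[of "degen_letter i d" i "Suc k"]
      by (simp add: degen_letter_below)
  next
    case 2
    then show ?thesis
      using swap_unit_right assms(2) degen_swap_unit_lower(1)[of i "degen_letter i c" "Suc k"]
      by (simp add: degen_letter_above degen_letter_le)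
  qed (use swap_unit_right in \<open>simp add: bcong.swap_unit_right degen_letter_le degen_letter_less\<close>)
next
  case (swap_unit_left d c)
  consider "c = i" | "d = i" "c \<noteq> i" | "c \<noteq> i" "d \<noteq> i" by blast
  then show ?case
  proof cases
    case 1
    then show ?thesis
      using swap_unit_left assms(2) degen_swap_unit_upper(2)[of "degen_letter i d" i "Suc k"]
      by (simp add: degen_letter_below)
  next
    case 2
    then show ?thesis
      using swap_unit_left assms(2) degen_swap_unit_lower(2)[of i "degen_letter i c" "Suc k"]
      by (simp add: degen_letter_above degen_letter_le)
  qed (use swap_unit_left in \<open>simp add: bcong.swap_unit_left degen_letter_le degen_letter_less\<close>)
next
  case (Id_left f)
  then show ?case using assms(2) degen_term_typed[of i k f] by (simp add: bcong_Id_left)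
next
  case (Id_right f)
  then show ?case
    using assms(2) degen_term_typed[of i k f] bcong.Id_right[of "Suc k" "degen_term i f"] by simp
next
  case (Tens_Id v w)
  then show ?case using assms(2) set_degen_word by (simp add: bcong.Tens_Id)
qed (simp_all add: degen_term_typed[OF assms(2)] bcong.refl bcong.Tens_cong bcong.Comp_assoc bcong.Tens_assoc
      bcong.Tens_unit_left bcong.Tens_unit_right bcong.interchange)

lemma bface_bmor_of:
  assumes "wf_term (Suc k) f" "i \<le> Suc k"
  shows "bface (Suc k) i (bmor_of (Suc k) f) = bmor_of k (face_term i f)"
proof -
  have eq: "bmor_of k (face_term i f') = bmor_of k (face_term i f)"
    if "f' \<in> bmor_of (Suc k) f" for f'
    using that bmor_of_eqI[OF face_term_bcong[OF _ assms(2)]] by (simp add: bmor_of_def)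
  have "f \<in> bmor_of (Suc k) f"
    using assms by (simp add: bmor_of_def bcong.refl)
  with eq show ?thesis
    unfolding bface_def diff_Suc_1 by blast
qed

lemma bdegen_bmor_of:
  assumes "wf_term k f" "i \<le> k"
  shows "bdegen k i (bmor_of k f) = bmor_of (Suc k) (degen_term i f)"
proof -
  have eq: "bmor_of (Suc k) (degen_term i f') = bmor_of (Suc k) (degen_term i f)"
    if "f' \<in> bmor_of k f" for f'
    using that bmor_of_eqI[OF degen_term_bcong[OF _ assms(2)]] by (simp add: bmor_of_def)
  have "f \<in> bmor_of k f"
    using assms by (simp add: bmor_of_def bcong.refl)
  with eq show ?thesis
    unfolding bdegen_def by blast
qed


section \<open>The operad TW\<close>

definition bracket :: "nat \<Rightarrow> word" where
  "bracket k = [0..<Suc k]"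

definition bracket_pow :: "nat \<Rightarrow> nat \<Rightarrow> word" where
  "bracket_pow k n = concat (replicate n (bracket k))"

definition TW :: "nat \<Rightarrow> bmor sset" where
  "TW n = \<lparr>simplices = \<lambda>k. bhom k (bracket_pow k n) (bracket k),
           face = bface, degen = bdegen\<rparr>"

definition TW_comp :: "nat list \<Rightarrow> nat \<Rightarrow> bmor \<Rightarrow> bmor list \<Rightarrow> bmor" where
  "TW_comp ms k F Gs = bcomp k F (foldr (btens k) Gs (bid k []))"

definition TW_unit :: "nat \<Rightarrow> bmor" where
  "TW_unit k = bid k (bracket k)"

end

theory Submission
  imports Defs "HOL-Analysis.Abstract_Topological_Spaces"
begin

text \<open>
  The operad axioms only express that \<open>\<B>_k\<close> is a strict monoidal category and that the faces
  and degeneracies are strict monoidal functors subject to the simplicial identities. The content is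
  that each \<open>TW(n)\<close> is weakly contractible, and this holds because \<open>TW(n)\<close> has an extra degeneracy.

  Relabelling \<open>j \<mapsto> j + 1\<close> embeds \<open>\<B>_k\<close> into the part of \<open>\<B>_{k+1}\<close> that does not involve the
  letter \<open>0\<close>. Since \<open>t\<^sup>c\<^sup>,\<^sup>0\<close> exists for every \<open>c > 0\<close>, all zeros of \<open>[k+1]\<^sup>n\<close> can be moved to the left;
  call this morphism \<open>\<sigma> : [k+1]\<^sup>n \<rightarrow> (0)\<^sup>n \<squnion> (1, \<dots>, k+1)\<^sup>n\<close>. Fix one bracketing
  \<open>\<mu> : (0)\<^sup>n \<rightarrow> (0)\<close> of the \<open>n\<close>-fold product. A simplex \<open>f : [k]\<^sup>n \<rightarrow> [k]\<close>, relabelled to \<open>f'\<close>, yields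
  \<open>e(f) = (\<mu> \<squnion> f') \<circ> \<sigma> : [k+1]\<^sup>n \<rightarrow> [k+1]\<close>. Applying \<open>d_0\<close> erases \<open>\<mu>\<close> and \<open>\<sigma>\<close> and undoes
  the relabelling, so \<open>d_0 e(f) = f\<close>. A face \<open>d_{i+1}\<close> or degeneracy \<open>s_{i+1}\<close> leaves \<open>\<mu>\<close> alone
  and sends \<open>\<sigma>\<close> to the corresponding \<open>\<sigma>\<close>, so \<open>d_{i+1} e = e d_i\<close> and \<open>s_{i+1} e = e s_i\<close>.
  For a vertex \<open>f\<close>, \<open>d_1 e(f) = \<mu>\<close> is independent of \<open>f\<close>. This is the content of
  \<open>extra_degeneracy_TW\<close>.

  An extra degeneracy contracts the realization: \<open>e(x)\<close> is a cone on \<open>x\<close> with a new initial vertex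
  as its apex, and \<open>H(s, (x, t)) = (e(x), (s, (1 - s) t))\<close> moves every point along a straight line to
  that apex. The identities for \<open>d_{i+1}\<close> and \<open>s_{i+1}\<close> make \<open>H\<close> respect the gluing, \<open>d_0 e = id\<close>
  makes it start at the identity, and \<open>d_1 e(f) = \<mu>\<close> makes all apexes represent the single point
  \<open>\<mu>\<close> (\<open>contractible_space_realization\<close>). A contractible space has
  trivial homotopy groups at every base point (\<open>contractible_imp_trivial_homotopy_group\<close>).

  All equations between morphisms come down to comparing formal terms. A term is flattened into the
  list of its generators, each tensored with identities on both sides. Two terms with the same source
  whose lists agree, up to exchanging neighbouring generators that act on disjoint positions, are
  congruent (\<open>bcong_slidesI\<close>). For concrete terms, the lists are computed by the simplifier.
\<close>

section \<open>Diagrams as lists of whiskered generators\<close>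

declare bcong.trans [trans]

text \<open>
  The step \<open>(l, G, r)\<close> stands for the generator \<open>G\<close> placed between identities on the words \<open>l\<close>
  and \<open>r\<close>. A list of steps is read in the order of application.
\<close>

type_synonym step = "word \<times> bterm \<times> word"

definition whisk :: "word \<Rightarrow> word \<Rightarrow> step \<Rightarrow> step" where
  "whisk l r = (\<lambda>(a, G, b). (l @ a, G, b @ r))"

lemma whisk_simp [simp]: "whisk l r (a, G, b) = (l @ a, G, b @ r)"
  by (simp add: whisk_def)

lemma whisk_whisk [simp]: "whisk l r (whisk l' r' s) = whisk (l @ l') (r' @ r) s"
  by (cases s) simp

lemma whisk_Nil [simp]: "whisk [] [] = id"
  by (auto simp: whisk_def)

text \<open>
  In \<open>f \<parallel> g\<close> the left factor acts first. This is a convention: letting the right factor act first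
  gives a list that differs by slides, as defined below.
\<close>

primrec steps :: "bterm \<Rightarrow> step list" where
  "steps (IdG w) = []"
| "steps (UG a) = [([], UG a, [])]"
| "steps (MG a) = [([], MG a, [])]"
| "steps (TG c d) = [([], TG c d, [])]"
| "steps (f \<cdot> g) = steps g @ steps f"
| "steps (f \<parallel> g) = map (whisk [] (src g)) (steps f) @ map (whisk (tgt f) []) (steps g)"

text \<open>
  The condition \<open>steps G = [([], G, [])]\<close> says that \<open>G\<close> is a single generator.
\<close>

fun typed_steps :: "nat \<Rightarrow> word \<Rightarrow> step list \<Rightarrow> word \<Rightarrow> bool" where
  "typed_steps k v [] w \<longleftrightarrow> v = w \<and> set v \<subseteq> {0..k}"
| "typed_steps k v ((l, G, r) # xs) w \<longleftrightarrow>
    v = l @ src G @ r \<and> wf_term k G \<and> steps G = [([], G, [])] \<and>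
    set l \<subseteq> {0..k} \<and> set r \<subseteq> {0..k} \<and>
    typed_steps k (l @ tgt G @ r) xs w"

fun run :: "word \<Rightarrow> step list \<Rightarrow> bterm" where
  "run v [] = IdG v"
| "run v ((l, G, r) # xs) = run (l @ tgt G @ r) xs \<cdot> (IdG l \<parallel> G \<parallel> IdG r)"

lemma set_typed_steps: "typed_steps k v xs w \<Longrightarrow> set v \<subseteq> {0..k} \<and> set w \<subseteq> {0..k}"
  by (induction k v xs w rule: typed_steps.induct) (auto dest: wf_term_words)

lemma run_typed:
  "typed_steps k v xs w \<Longrightarrow> wf_term k (run v xs) \<and> src (run v xs) = v \<and> tgt (run v xs) = w"
  by (induction k v xs w rule: typed_steps.induct) auto

lemma typed_steps_append:
  "typed_steps k v (xs @ ys) w \<longleftrightarrow> (\<exists>u. typed_steps k v xs u \<and> typed_steps k u ys w)"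
proof (induction xs arbitrary: v)
  case Nil
  show ?case using set_typed_steps[of k v ys w] by auto
next
  case (Cons s xs)
  then show ?case by (cases s) auto
qed

lemma run_append:
  assumes "typed_steps k v xs u" "typed_steps k u ys w"
  shows "(run v (xs @ ys), run u ys \<cdot> run v xs) \<in> bcong k"
  using assms(1)
proof (induction xs arbitrary: v)
  case Nil
  then show ?case
    using run_typed[OF assms(2)] bcong.sym[OF bcong.Id_right] by fastforce
next
  case (Cons s xs)
  obtain l G r where s: "s = (l, G, r)" by (cases s)
  let ?v = "l @ tgt G @ r" and ?S = "IdG l \<parallel> G \<parallel> IdG r"
  have p: "typed_steps k ?v xs u" and wf: "wf_term k ?S" "tgt ?S = ?v"
    using Cons.prems s by auto
  note t = run_typed[OF p] run_typed[OF assms(2)]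
  have "(run ?v (xs @ ys) \<cdot> ?S, (run u ys \<cdot> run ?v xs) \<cdot> ?S) \<in> bcong k"
    using Cons.IH[OF p] wf t bcong_typed[OF Cons.IH[OF p]]
    by (intro bcong.Comp_cong bcong.refl) simp_all
  also have "((run u ys \<cdot> run ?v xs) \<cdot> ?S, run u ys \<cdot> (run ?v xs \<cdot> ?S)) \<in> bcong k"
    using wf t by (intro bcong.Comp_assoc) simp_all
  finally show ?case by (simp add: s)
qed

lemma bcong_whisker_Id:
  assumes "set l \<subseteq> {0..k}" "set v \<subseteq> {0..k}" "set r \<subseteq> {0..k}"
  shows "(IdG l \<parallel> IdG v \<parallel> IdG r, IdG (l @ v @ r)) \<in> bcong k"
proof -
  have "(IdG l \<parallel> IdG v \<parallel> IdG r, IdG l \<parallel> IdG (v @ r)) \<in> bcong k"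
    using assms by (intro bcong.Tens_cong bcong.refl bcong.Tens_Id) simp_all
  also have "(IdG l \<parallel> IdG (v @ r), IdG (l @ v @ r)) \<in> bcong k"
    using assms by (intro bcong.Tens_Id) simp_all
  finally show ?thesis .
qed

lemma bcong_whisker_Comp:
  assumes "wf_term k (f \<cdot> g)" "set l \<subseteq> {0..k}" "set r \<subseteq> {0..k}"
  shows "((IdG l \<parallel> f \<parallel> IdG r) \<cdot> (IdG l \<parallel> g \<parallel> IdG r), IdG l \<parallel> (f \<cdot> g) \<parallel> IdG r) \<in> bcong k"
  using assms by (intro bcong_Tens_Comp bcong_Id_left bcong.refl) simp_all

lemma bcong_whisker_whisker:
  assumes "wf_term k G" "set l \<subseteq> {0..k}" "set a \<subseteq> {0..k}" "set b \<subseteq> {0..k}" "set r \<subseteq> {0..k}"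
  shows "(IdG (l @ a) \<parallel> G \<parallel> IdG (b @ r), IdG l \<parallel> (IdG a \<parallel> G \<parallel> IdG b) \<parallel> IdG r) \<in> bcong k"
proof -
  have "(IdG (l @ a) \<parallel> (G \<parallel> IdG (b @ r)), (IdG l \<parallel> IdG a) \<parallel> (G \<parallel> (IdG b \<parallel> IdG r))) \<in> bcong k"
    using assms by (intro bcong.Tens_cong bcong.refl bcong.sym[OF bcong.Tens_Id]) simp_all
  also have "((IdG l \<parallel> IdG a) \<parallel> (G \<parallel> (IdG b \<parallel> IdG r)), (IdG l \<parallel> IdG a) \<parallel> ((G \<parallel> IdG b) \<parallel> IdG r)) \<in> bcong k"
    using assms by (intro bcong.Tens_cong bcong.refl bcong_Tens_assoc') simp_all
  also have "((IdG l \<parallel> IdG a) \<parallel> ((G \<parallel> IdG b) \<parallel> IdG r), IdG l \<parallel> (IdG a \<parallel> ((G \<parallel> IdG b) \<parallel> IdG r))) \<in> bcong k"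
    using assms by (intro bcong.Tens_assoc) simp_all
  also have "(IdG l \<parallel> (IdG a \<parallel> ((G \<parallel> IdG b) \<parallel> IdG r)), IdG l \<parallel> (IdG a \<parallel> G \<parallel> IdG b) \<parallel> IdG r) \<in> bcong k"
    using assms by (intro bcong.Tens_cong bcong.refl bcong_Tens_assoc') simp_all
  finally show ?thesis .
qed

lemma run_whisk:
  assumes "typed_steps k v xs w" "set l \<subseteq> {0..k}" "set r \<subseteq> {0..k}"
  shows "typed_steps k (l @ v @ r) (map (whisk l r) xs) (l @ w @ r) \<and>
    (run (l @ v @ r) (map (whisk l r) xs), IdG l \<parallel> run v xs \<parallel> IdG r) \<in> bcong k"
  using assms(1)
proof (induction xs arbitrary: v)
  case Nil
  then show ?case
    using assms(2,3) by (auto intro: bcong.sym[OF bcong_whisker_Id])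
next
  case (Cons s xs)
  obtain a G b where s: "s = (a, G, b)" by (cases s)
  let ?v = "a @ tgt G @ b" and ?S = "IdG a \<parallel> G \<parallel> IdG b"
  have p: "typed_steps k ?v xs w" and wf: "wf_term k G" "steps G = [([], G, [])]" "set a \<subseteq> {0..k}" "set b \<subseteq> {0..k}"
    and v: "v = a @ src G @ b"
    using Cons.prems s by auto
  note t = run_typed[OF p] and IH = Cons.IH[OF p]
  have "(run (l @ ?v @ r) (map (whisk l r) xs) \<cdot> (IdG (l @ a) \<parallel> G \<parallel> IdG (b @ r)),
      (IdG l \<parallel> run ?v xs \<parallel> IdG r) \<cdot> (IdG l \<parallel> ?S \<parallel> IdG r)) \<in> bcong k"
    using IH assms(2,3) wf t run_typed[OF IH[THEN conjunct1]]
    by (intro bcong.Comp_cong bcong_whisker_whisker) simp_all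
  also have "((IdG l \<parallel> run ?v xs \<parallel> IdG r) \<cdot> (IdG l \<parallel> ?S \<parallel> IdG r),
      IdG l \<parallel> (run ?v xs \<cdot> ?S) \<parallel> IdG r) \<in> bcong k"
    using assms(2,3) wf t by (intro bcong_whisker_Comp) simp_all
  finally show ?case
    using IH wf assms(2,3) by (simp add: s v)
qed

lemma bcong_unwhisker:
  assumes "wf_term k f"
  shows "(IdG [] \<parallel> f \<parallel> IdG [], f) \<in> bcong k"
  using assms by (intro bcong.trans[OF bcong.Tens_unit_left bcong.Tens_unit_right]) simp_all

lemma bcong_Tens_split:
  assumes "wf_term k f" "wf_term k g"
  shows "(f \<parallel> g, (IdG (tgt f) \<parallel> g \<parallel> IdG []) \<cdot> (IdG [] \<parallel> f \<parallel> IdG (src g))) \<in> bcong k"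
proof -
  have w: "set (tgt f) \<subseteq> {0..k}" "set (src g) \<subseteq> {0..k}"
    using wf_term_words assms by auto
  have "(f \<parallel> g, (IdG (tgt f) \<cdot> f) \<parallel> (g \<cdot> IdG (src g))) \<in> bcong k"
    using assms by (intro bcong.Tens_cong bcong.sym[OF bcong.Id_left] bcong.sym[OF bcong.Id_right])
  also have "((IdG (tgt f) \<cdot> f) \<parallel> (g \<cdot> IdG (src g)), (IdG (tgt f) \<parallel> g) \<cdot> (f \<parallel> IdG (src g))) \<in> bcong k"
    using assms w by (intro bcong.sym[OF bcong.interchange]) simp_all
  also have "((IdG (tgt f) \<parallel> g) \<cdot> (f \<parallel> IdG (src g)),
      (IdG (tgt f) \<parallel> g \<parallel> IdG []) \<cdot> (IdG [] \<parallel> f \<parallel> IdG (src g))) \<in> bcong k"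
    using assms w
    by (intro bcong.Comp_cong bcong.Tens_cong bcong.refl bcong.sym[OF bcong.Tens_unit_left]
        bcong.sym[OF bcong.Tens_unit_right]) simp_all
  finally show ?thesis .
qed

text \<open>
  Flattening is sound: by functoriality of \<open>\<parallel>\<close>, a tensor product is the composite of its two
  factors padded by identities, and padding distributes over composition.
\<close>

lemma bcong_run_steps:
  assumes "wf_term k f"
  shows "typed_steps k (src f) (steps f) (tgt f) \<and> (f, run (src f) (steps f)) \<in> bcong k"
  using assms
proof (induction f)
  case (IdG w)
  then show ?case by (simp add: bcong.refl)
next
  case (UG a)
  then show ?case
    using bcong.sym[OF bcong_Comp_right[OF bcong_unwhisker bcong_Id_left], of k "UG a"] by simp
next
  case (MG a)
  then show ?case
    using bcong.sym[OF bcong_Comp_right[OF bcong_unwhisker bcong_Id_left], of k "MG a"] by simp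
next
  case (TG c d)
  then show ?case
    using bcong.sym[OF bcong_Comp_right[OF bcong_unwhisker bcong_Id_left], of k "TG c d"] by simp
next
  case (Comp f g)
  then have f: "typed_steps k (src f) (steps f) (tgt f)" "(f, run (src f) (steps f)) \<in> bcong k"
    and g: "typed_steps k (src g) (steps g) (src f)" "(g, run (src g) (steps g)) \<in> bcong k"
    and wf: "src f = tgt g" by auto
  have "(f \<cdot> g, run (src f) (steps f) \<cdot> run (src g) (steps g)) \<in> bcong k"
    using f g wf by (intro bcong.Comp_cong) simp_all
  also have "(run (src f) (steps f) \<cdot> run (src g) (steps g), run (src g) (steps g @ steps f)) \<in> bcong k"
    by (rule bcong.sym[OF run_append[OF g(1) f(1)]])
  finally show ?case
    using f g by (auto simp: typed_steps_append)
next
  case (Tens f g)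
  then have f: "typed_steps k (src f) (steps f) (tgt f)" "(f, run (src f) (steps f)) \<in> bcong k"
    and g: "typed_steps k (src g) (steps g) (tgt g)" "(g, run (src g) (steps g)) \<in> bcong k"
    and wf: "wf_term k f" "wf_term k g" by auto
  let ?f = "map (whisk [] (src g)) (steps f)" and ?g = "map (whisk (tgt f) []) (steps g)"
  have w: "set (tgt f) \<subseteq> {0..k}" "set (src g) \<subseteq> {0..k}" "set (src f) \<subseteq> {0..k}"
    using wf_term_words wf by auto
  note F = run_whisk[OF f(1), of "[]" "src g", simplified]
   and G = run_whisk[OF g(1), of "tgt f" "[]", simplified]
  have F': "(IdG [] \<parallel> f \<parallel> IdG (src g), run (src f @ src g) ?f) \<in> bcong k"
    using F f(2) w
    by (intro bcong.trans[OF bcong.Tens_cong[OF bcong.refl bcong.Tens_cong[OF _ bcong.refl]] bcong.sym])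
      auto
  have G': "(IdG (tgt f) \<parallel> g \<parallel> IdG [], run (tgt f @ src g) ?g) \<in> bcong k"
    using G g(2) w
    by (intro bcong.trans[OF bcong.Tens_cong[OF bcong.refl bcong.Tens_cong[OF _ bcong.refl]] bcong.sym])
      auto
  have p: "typed_steps k (src f @ src g) ?f (tgt f @ src g)" "typed_steps k (tgt f @ src g) ?g (tgt f @ tgt g)"
    using F G w by auto
  have "(f \<parallel> g, (IdG (tgt f) \<parallel> g \<parallel> IdG []) \<cdot> (IdG [] \<parallel> f \<parallel> IdG (src g))) \<in> bcong k"
    using wf by (rule bcong_Tens_split)
  also have "((IdG (tgt f) \<parallel> g \<parallel> IdG []) \<cdot> (IdG [] \<parallel> f \<parallel> IdG (src g)),
      run (tgt f @ src g) ?g \<cdot> run (src f @ src g) ?f) \<in> bcong k"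
    using F' G' by (intro bcong.Comp_cong) simp_all
  also have "(run (tgt f @ src g) ?g \<cdot> run (src f @ src g) ?f, run (src f @ src g) (?f @ ?g)) \<in> bcong k"
    by (rule bcong.sym[OF run_append[OF p]])
  finally show ?case
    using p by (auto simp: typed_steps_append)
qed

text \<open>
  Both orders of two generators on disjoint positions are flattenings of terms that the interchange
  law identifies: of \<open>G \<parallel> id \<parallel> H\<close>, where \<open>G\<close> acts first, and of the same diagram written as a
  composite in which \<open>H\<close> acts first.
\<close>

lemma bcong_run_slide_two:
  assumes G: "wf_term k G" "steps G = [([], G, [])]" and H: "wf_term k H" "steps H = [([], H, [])]"
    and w: "set l \<subseteq> {0..k}" "set m \<subseteq> {0..k}" "set r \<subseteq> {0..k}"
  defines "v \<equiv> l @ src G @ m @ src H @ r"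
  shows "(run v [(l, G, m @ src H @ r), (l @ tgt G @ m, H, r)],
     run v [(l @ src G @ m, H, r), (l, G, m @ tgt H @ r)]) \<in> bcong k"
proof -
  let ?GH = "IdG l \<parallel> (G \<parallel> IdG m \<parallel> H) \<parallel> IdG r"
  let ?HG = "IdG l \<parallel> ((G \<parallel> IdG (m @ tgt H)) \<cdot> (IdG (src G) \<parallel> (IdG m \<parallel> H))) \<parallel> IdG r"
  have w': "set (tgt G) \<subseteq> {0..k}" "set (src H) \<subseteq> {0..k}" "set (src G) \<subseteq> {0..k}" "set (tgt H) \<subseteq> {0..k}"
    using wf_term_words G H by auto
  have B: "(IdG m \<parallel> H, IdG (m @ tgt H) \<cdot> (IdG m \<parallel> H)) \<in> bcong k"
    using bcong.sym[OF bcong.Id_left, of k "IdG m \<parallel> H"] H w by simp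
  have "(run (src ?GH) (steps ?GH), ?GH) \<in> bcong k"
    using G H w by (intro bcong.sym[OF conjunct2[OF bcong_run_steps]]) simp
  also have "(?GH, ?HG) \<in> bcong k"
    using G H w w'
    by (intro bcong.Tens_cong bcong.refl bcong.sym[OF bcong_Tens_Comp] bcong.Id_right bcong.sym[OF B])
      simp_all
  also have "(?HG, run (src ?HG) (steps ?HG)) \<in> bcong k"
    using G H w w' by (intro conjunct2[OF bcong_run_steps]) simp
  finally show ?thesis
    by (simp add: v_def G H)
qed

lemma bcong_run_context:
  assumes "typed_steps k v xs u" "(run u ys, run u ys') \<in> bcong k"
    "typed_steps k u ys w" "typed_steps k u ys' w" "typed_steps k w zs z"
  shows "(run v (xs @ ys @ zs), run v (xs @ ys' @ zs)) \<in> bcong k"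
proof -
  have *: "(run v (xs @ q @ zs), (run w zs \<cdot> run u q) \<cdot> run v xs) \<in> bcong k"
    if "typed_steps k u q w" for q
  proof -
    have t: "typed_steps k u (q @ zs) z" using that assms by (auto simp: typed_steps_append)
    have "(run v (xs @ q @ zs), run u (q @ zs) \<cdot> run v xs) \<in> bcong k"
      using t assms by (intro run_append)
    also have "(run u (q @ zs) \<cdot> run v xs, (run w zs \<cdot> run u q) \<cdot> run v xs) \<in> bcong k"
      using t that assms
      by (intro bcong.Comp_cong run_append bcong.refl) (auto dest!: run_typed)
    finally show ?thesis .
  qed
  have "((run w zs \<cdot> run u ys) \<cdot> run v xs, (run w zs \<cdot> run u ys') \<cdot> run v xs) \<in> bcong k"
    using assms by (intro bcong.Comp_cong bcong.refl) (auto dest!: run_typed)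
  with *[OF assms(3)] bcong.sym[OF *[OF assms(4)]] show ?thesis
    by (blast intro: bcong.trans)
qed

text \<open>
  One slide moves a generator past its neighbour when both act on disjoint positions; \<open>m\<close> is the word
  between them.
\<close>

inductive slide :: "step list \<Rightarrow> step list \<Rightarrow> bool" where
  "slide (xs @ [(l, G, m @ src H @ r), (l @ tgt G @ m, H, r)] @ ys)
         (xs @ [(l @ src G @ m, H, r), (l, G, m @ tgt H @ r)] @ ys)"

abbreviation slides :: "step list \<Rightarrow> step list \<Rightarrow> bool" (infix "\<asymp>" 50) where
  "xs \<asymp> ys \<equiv> equivclp slide xs ys"

lemma slide_imp_bcong:
  assumes "slide xs ys"
  shows "typed_steps k v xs w \<longleftrightarrow> typed_steps k v ys w"
    and "typed_steps k v xs w \<Longrightarrow> (run v xs, run v ys) \<in> bcong k"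
proof -
  from assms obtain as l G m H r bs
    where xs: "xs = as @ [(l, G, m @ src H @ r), (l @ tgt G @ m, H, r)] @ bs"
      and ys: "ys = as @ [(l @ src G @ m, H, r), (l, G, m @ tgt H @ r)] @ bs"
    by cases
  show *: "typed_steps k v xs w \<longleftrightarrow> typed_steps k v ys w"
    unfolding xs ys typed_steps_append by (auto dest: wf_term_words)
  assume t: "typed_steps k v xs w"
  let ?u = "l @ src G @ m @ src H @ r" and ?u' = "l @ tgt G @ m @ tgt H @ r"
  have "typed_steps k v as ?u" "typed_steps k ?u' bs w"
    "wf_term k G" "steps G = [([], G, [])]" "wf_term k H" "steps H = [([], H, [])]"
    "set l \<subseteq> {0..k}" "set m \<subseteq> {0..k}" "set r \<subseteq> {0..k}"
    using t unfolding xs by (auto simp: typed_steps_append)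
  moreover from this have "typed_steps k ?u [(l, G, m @ src H @ r), (l @ tgt G @ m, H, r)] ?u'"
    "typed_steps k ?u [(l @ src G @ m, H, r), (l, G, m @ tgt H @ r)] ?u'"
    by (auto dest: wf_term_words)
  ultimately show "(run v xs, run v ys) \<in> bcong k"
    unfolding xs ys by - (rule bcong_run_context[OF _ bcong_run_slide_two])
qed

lemma slides_imp_bcong:
  assumes "xs \<asymp> ys" "typed_steps k v xs w"
  shows "typed_steps k v ys w \<and> (run v xs, run v ys) \<in> bcong k"
  using assms
proof (induction rule: equivclp_induct)
  case base
  then show ?case by (auto intro: bcong.refl dest: run_typed)
next
  case (step y z)
  then have y: "typed_steps k v y w" "(run v xs, run v y) \<in> bcong k" by auto
  from step.hyps(2) show ?case
  proof
    assume "slide y z"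
    from slide_imp_bcong[OF this] y show ?thesis by (blast intro: bcong.trans)
  next
    assume "slide z y"
    from slide_imp_bcong[OF this] y show ?thesis by (blast intro: bcong.trans bcong.sym)
  qed
qed

text \<open>
  The working principle for the remainder: congruences are proved by evaluating \<open>steps\<close> on both sides.
\<close>

theorem bcong_slidesI:
  assumes "wf_term k f" "wf_term k g" "src f = src g" "steps f \<asymp> steps g"
  shows "(f, g) \<in> bcong k"
  using bcong_run_steps[OF assms(1)] bcong_run_steps[OF assms(2)] slides_imp_bcong[OF assms(4)] assms(3)
  by (metis bcong.sym bcong.trans)

text \<open>
  A form of the basic slide whose words are matched by computation instead of by unification.
\<close>

lemma slides_swap:
  assumes "b = m @ src H @ r" "a' = l @ tgt G @ m" "a'' = l @ src G @ m" "b'' = m @ tgt H @ r"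
  shows "xs @ [(l, G, b), (a', H, r)] @ ys \<asymp> xs @ [(a'', H, r), (l, G, b'')] @ ys"
  unfolding assms by (intro r_into_equivclp slide.intros)

section \<open>The simplicial identities\<close>

text \<open>
  Two strict monoidal functors that agree on objects and on generators are equal. The map \<open>V\<close> is the
  common effect on objects.
\<close>

lemma bcong_on_generatorsI:
  assumes Comp: "\<And>f g. F (f \<cdot> g) = F f \<cdot> F g" "\<And>f g. F' (f \<cdot> g) = F' f \<cdot> F' g"
    and Tens: "\<And>f g. F (f \<parallel> g) = F f \<parallel> F g" "\<And>f g. F' (f \<parallel> g) = F' f \<parallel> F' g"
    and typed: "\<And>f. wf_term k f \<Longrightarrow> wf_term k' (F f) \<and> src (F f) = V (src f) \<and> tgt (F f) = V (tgt f)"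
      "\<And>f. wf_term k f \<Longrightarrow> wf_term k' (F' f) \<and> src (F' f) = V (src f) \<and> tgt (F' f) = V (tgt f)"
    and gens: "\<And>w. set w \<subseteq> {0..k} \<Longrightarrow> steps (F (IdG w)) \<asymp> steps (F' (IdG w))"
      "\<And>a. a \<le> k \<Longrightarrow> steps (F (UG a)) \<asymp> steps (F' (UG a))"
      "\<And>a. a \<le> k \<Longrightarrow> steps (F (MG a)) \<asymp> steps (F' (MG a))"
      "\<And>c d. d < c \<Longrightarrow> c \<le> k \<Longrightarrow> steps (F (TG c d)) \<asymp> steps (F' (TG c d))"
    and wf: "wf_term k f"
  shows "(F f, F' f) \<in> bcong k'"
  using wf
proof (induction f)
  case (Comp f g)
  then show ?case
    using typed(1)[of f] typed(1)[of g] by (simp add: assms(1,2) bcong.Comp_cong)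
next
  case (Tens f g)
  then show ?case by (simp add: assms(3,4) bcong.Tens_cong)
qed (rule bcong_slidesI; use typed gens in simp)+


text \<open>
  The identities for letters are stated for a fixed pair of indices, one rewrite rule per possible
  coincidence of a letter with an index. This keeps the case distinctions on generators below free of
  arithmetic.
\<close>

lemma face_letter_face_letter:
  assumes "i \<le> j"
  shows "face_letter (Suc j) i = i" "face_letter i (Suc j) = j"
    and "a \<noteq> Suc j \<Longrightarrow> face_letter (Suc j) a = i \<longleftrightarrow> a = i"
    and "a \<noteq> i \<Longrightarrow> face_letter i a = j \<longleftrightarrow> a = Suc j"
    and "\<lbrakk>a \<noteq> i; a \<noteq> Suc j\<rbrakk> \<Longrightarrow>
      face_letter i (face_letter (Suc j) a) = face_letter j (face_letter i a)"
  using assms by (auto simp: face_letter_def)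

lemma face_degen_letter_less:
  assumes "i < Suc j"
  shows "degen_letter (Suc j) a = i \<longleftrightarrow> a = i"
    and "face_letter i (Suc j) = j" "face_letter i (Suc (Suc j)) = Suc j"
    and "a \<noteq> i \<Longrightarrow> face_letter i a = j \<longleftrightarrow> a = Suc j"
    and "\<lbrakk>a \<noteq> i; a \<noteq> Suc j\<rbrakk> \<Longrightarrow>
      face_letter i (degen_letter (Suc j) a) = degen_letter j (face_letter i a)"
  using assms by (auto simp: face_letter_def degen_letter_def)

lemma face_degen_letter_same:
  assumes "i = j \<or> i = Suc j" "a \<noteq> j"
  shows "degen_letter j a \<noteq> i" "face_letter i (degen_letter j a) = a"
  using assms by (auto simp: face_letter_def degen_letter_def)

lemma face_letter_adjacent:
  "face_letter i (Suc i) = i" "face_letter (Suc i) i = i"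
  by (auto simp: face_letter_def)

lemma face_degen_letter_greater:
  assumes "j < i"
  shows "face_letter (Suc i) j = j" "face_letter (Suc i) (Suc j) = Suc j" "face_letter i j = j"
    and "a \<noteq> j \<Longrightarrow> degen_letter j a = Suc i \<longleftrightarrow> a = i"
    and "a \<noteq> i \<Longrightarrow> face_letter i a = j \<longleftrightarrow> a = j"
    and "\<lbrakk>a \<noteq> i; a \<noteq> j\<rbrakk> \<Longrightarrow>
      face_letter (Suc i) (degen_letter j a) = degen_letter j (face_letter i a)"
  using assms by (auto simp: face_letter_def degen_letter_def)

lemma degen_letter_degen_letter:
  assumes "i < j"
  shows "degen_letter j i = i" "degen_letter j (Suc i) = (if j = Suc i then Suc j else Suc i)"
    "degen_letter (Suc j) i = i" "degen_letter (Suc j) (Suc i) = Suc i"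
    "degen_letter i j = Suc j" "degen_letter i (Suc j) = Suc (Suc j)"
    and "degen_letter j a = i \<longleftrightarrow> a = i"
    and "a \<noteq> i \<Longrightarrow> degen_letter i a = Suc j \<longleftrightarrow> a = j"
    and "degen_letter i (degen_letter j a) = degen_letter (Suc j) (degen_letter i a)"
  using assms by (auto simp: degen_letter_def)

lemma degen_letter_degen_letter_same:
  assumes "a \<noteq> i"
  shows "degen_letter i a \<noteq> i" "degen_letter i a \<noteq> Suc i"
    "degen_letter i (degen_letter i a) = degen_letter (Suc i) (degen_letter i a)"
  using assms by (auto simp: degen_letter_def)

lemma degen_letter_adjacent:
  "degen_letter i (Suc i) = Suc (Suc i)" "degen_letter (Suc i) i = i"
  by (auto simp: degen_letter_def)

lemma face_word_face_word:
  assumes "i \<le> j"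
  shows "face_word i (face_word (Suc j) w) = face_word j (face_word i w)"
proof (induction w)
  case (Cons a w)
  then show ?case
    using assms by (cases "a = i"; cases "a = Suc j") (simp_all add: face_letter_face_letter[OF assms])
qed simp

text \<open>
  For two faces the composites agree already as terms, because a face sends the generators that it
  does not relabel to identity terms. Well-formedness excludes \<open>TG c c\<close>.
\<close>

lemma face_term_face_term:
  assumes "i \<le> j" "wf_term k f"
  shows "face_term i (face_term (Suc j) f) = face_term j (face_term i f)"
  using assms(2)
proof (induction f)
  case (UG a)
  then show ?case
    using assms(1) by (cases "a = i"; cases "a = Suc j") (simp_all add: face_letter_face_letter[OF assms(1)])
next
  case (MG a)
  then show ?case
    using assms(1) by (cases "a = i"; cases "a = Suc j") (simp_all add: face_letter_face_letter[OF assms(1)])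
next
  case (TG c d)
  then have "d < c" by simp
  then show ?case
    using assms(1) by (cases "c = i"; cases "c = Suc j"; cases "d = i"; cases "d = Suc j")
      (simp_all add: face_letter_face_letter[OF assms(1)])
qed (simp_all add: face_word_face_word[OF assms(1)])

lemma face_word_degen_word_less:
  "i < Suc j \<Longrightarrow> face_word i (degen_word (Suc j) w) = degen_word j (face_word i w)"
  by (induction w) (simp_all add: face_degen_letter_less)

lemma face_word_degen_word_same:
  "i = j \<or> i = Suc j \<Longrightarrow> face_word i (degen_word j w) = w"
  by (induction w) (auto simp: face_degen_letter_same face_letter_adjacent)

lemma face_word_degen_word_greater:
  "j < i \<Longrightarrow> face_word (Suc i) (degen_word j w) = degen_word j (face_word i w)"
  by (induction w) (auto simp: face_degen_letter_greater)

lemma degen_word_degen_word: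
  assumes "i \<le> j"
  shows "degen_word i (degen_word j w) = degen_word (Suc j) (degen_word i w)"
proof (cases "i = j")
  case True
  then show ?thesis
    by (induction w) (simp_all add: degen_letter_degen_letter_same degen_letter_adjacent)
next
  case False
  then have "i < j" using assms by simp
  then show ?thesis
    by (induction w) (simp_all add: degen_letter_degen_letter[OF \<open>i < j\<close>])
qed

lemma face_term_degen_term_typed:
  assumes "wf_term k f" "i \<le> Suc k" "j \<le> k"
  shows "wf_term k (face_term i (degen_term j f)) \<and>
    src (face_term i (degen_term j f)) = face_word i (degen_word j (src f)) \<and>
    tgt (face_term i (degen_term j f)) = face_word i (degen_word j (tgt f))"
  using assms degen_term_typed[of j k f] face_term_typed[of i k "degen_term j f"] by simp

lemma degen_term_face_term_typed:
  assumes "wf_term (Suc k) f" "i \<le> Suc k" "j \<le> k"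
  shows "wf_term (Suc k) (degen_term j (face_term i f)) \<and>
    src (degen_term j (face_term i f)) = degen_word j (face_word i (src f)) \<and>
    tgt (degen_term j (face_term i f)) = degen_word j (face_word i (tgt f))"
  using assms degen_term_typed[of j k "face_term i f"] face_term_typed[of i k f] by simp

lemma degen_term_degen_term_typed:
  assumes "wf_term k f" "i \<le> Suc k" "j \<le> k"
  shows "wf_term (Suc (Suc k)) (degen_term i (degen_term j f)) \<and>
    src (degen_term i (degen_term j f)) = degen_word i (degen_word j (src f)) \<and>
    tgt (degen_term i (degen_term j f)) = degen_word i (degen_word j (tgt f))"
  using assms degen_term_typed[of j k f] degen_term_typed[of i "Suc k" "degen_term j f"] by simp


lemma face_degen_term_less:
  assumes "wf_term (Suc k) f" "i < Suc j" "j \<le> k"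
  shows "(face_term i (degen_term (Suc j) f), degen_term j (face_term i f)) \<in> bcong (Suc k)"
proof (rule bcong_on_generatorsI[where F = "\<lambda>f. face_term i (degen_term (Suc j) f)" and
      F' = "\<lambda>f. degen_term j (face_term i f)" and
      k = "Suc k" and V = "\<lambda>w. face_word i (degen_word (Suc j) w)"])
  note [simp] = face_degen_letter_less[OF assms(2)]
  show "steps (face_term i (degen_term (Suc j) (UG a))) \<asymp> steps (degen_term j (face_term i (UG a)))" for a
    using assms(2) by (cases "a = i"; cases "a = Suc j") simp_all
  show "steps (face_term i (degen_term (Suc j) (MG a))) \<asymp> steps (degen_term j (face_term i (MG a)))" for a
    using assms(2) by (cases "a = i"; cases "a = Suc j") simp_all
  show "steps (face_term i (degen_term (Suc j) (TG c d))) \<asymp> steps (degen_term j (face_term i (TG c d)))"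
    if "d < c" for c d
    using assms(2) that by (cases "c = i"; cases "c = Suc j"; cases "d = i"; cases "d = Suc j") simp_all
  fix f assume "wf_term (Suc k) f"
  then show "wf_term (Suc k) (face_term i (degen_term (Suc j) f)) \<and>
      src (face_term i (degen_term (Suc j) f)) = face_word i (degen_word (Suc j) (src f)) \<and>
      tgt (face_term i (degen_term (Suc j) f)) = face_word i (degen_word (Suc j) (tgt f))"
    and "wf_term (Suc k) (degen_term j (face_term i f)) \<and>
      src (degen_term j (face_term i f)) = face_word i (degen_word (Suc j) (src f)) \<and>
      tgt (degen_term j (face_term i f)) = face_word i (degen_word (Suc j) (tgt f))"
    using assms face_term_degen_term_typed[of "Suc k" f i "Suc j"] degen_term_face_term_typed[of k f i j]
    by (simp_all add: face_word_degen_word_less)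
qed (use assms in simp_all)

lemma face_degen_term_same:
  assumes "wf_term k f" "i = j \<or> i = Suc j" "j \<le> k"
  shows "(face_term i (degen_term j f), f) \<in> bcong k"
proof (rule bcong_on_generatorsI[where F = "\<lambda>f. face_term i (degen_term j f)" and
      F' = "\<lambda>f. f" and k = k and V = "\<lambda>w. w"])
  note [simp] = face_degen_letter_same face_letter_adjacent
  show "steps (face_term i (degen_term j (MG a))) \<asymp> steps (MG a)" for a
    using assms(2) by (cases "a = j") auto
  show "steps (face_term i (degen_term j (TG c d))) \<asymp> steps (TG c d)" if "d < c" for c d
    using assms(2) that by (cases "c = j"; cases "d = j") auto
  show "steps (face_term i (degen_term j (UG a))) \<asymp> steps (UG a)" for a
    using assms(2) by (cases "a = j") auto
  fix f assume "wf_term k f"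
  then show "wf_term k (face_term i (degen_term j f)) \<and>
      src (face_term i (degen_term j f)) = src f \<and> tgt (face_term i (degen_term j f)) = tgt f"
    using assms face_term_degen_term_typed[of k f i j] by (auto simp: face_word_degen_word_same)
qed (use assms in simp_all)

lemma face_degen_term_greater:
  assumes "wf_term (Suc k) f" "j < i" "i \<le> Suc k"
  shows "(face_term (Suc i) (degen_term j f), degen_term j (face_term i f)) \<in> bcong (Suc k)"
proof (rule bcong_on_generatorsI[where F = "\<lambda>f. face_term (Suc i) (degen_term j f)" and
      F' = "\<lambda>f. degen_term j (face_term i f)" and
      k = "Suc k" and V = "\<lambda>w. face_word (Suc i) (degen_word j w)"])
  note [simp] = face_degen_letter_greater[OF assms(2)]
  show "steps (face_term (Suc i) (degen_term j (MG a))) \<asymp> steps (degen_term j (face_term i (MG a)))" for a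
    using assms(2) by (cases "a = i"; cases "a = j") simp_all
  show "steps (face_term (Suc i) (degen_term j (UG a))) \<asymp> steps (degen_term j (face_term i (UG a)))" for a
    using assms(2) by (cases "a = i"; cases "a = j") simp_all
  show "steps (face_term (Suc i) (degen_term j (TG c d))) \<asymp> steps (degen_term j (face_term i (TG c d)))"
    if "d < c" for c d
    using assms(2) that by (cases "c = i"; cases "c = j"; cases "d = i"; cases "d = j") simp_all
  fix f assume "wf_term (Suc k) f"
  then show "wf_term (Suc k) (face_term (Suc i) (degen_term j f)) \<and>
      src (face_term (Suc i) (degen_term j f)) = face_word (Suc i) (degen_word j (src f)) \<and>
      tgt (face_term (Suc i) (degen_term j f)) = face_word (Suc i) (degen_word j (tgt f))"
    and "wf_term (Suc k) (degen_term j (face_term i f)) \<and>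
      src (degen_term j (face_term i f)) = face_word (Suc i) (degen_word j (src f)) \<and>
      tgt (degen_term j (face_term i f)) = face_word (Suc i) (degen_word j (tgt f))"
    using assms face_term_degen_term_typed[of "Suc k" f "Suc i" j] degen_term_face_term_typed[of k f i j]
    by (simp_all add: face_word_degen_word_greater)
qed (use assms in simp_all)

text \<open>
  Splitting the strand of \<open>m\<^sup>i\<close> twice gives the shuffle \<open>(a, b, c, a, b, c) \<rightarrow> (a, a, b, b, c, c)\<close>
  followed by three products. Depending on which half is split in the second step, the crossing of \<open>c\<close>
  with \<open>b\<close> comes before or after the crossing of \<open>b\<close> with \<open>a\<close> and the product on \<open>a\<close>; both act on
  positions to the left of it.
\<close>

lemma steps_degen_degen_mult:
  "steps (degen_term i (degen_term i (MG i))) \<asymp> steps (degen_term (Suc i) (degen_term i (MG i)))"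
proof -
  define a b c where "a = i" and "b = Suc i" and "c = Suc (Suc i)"
  let ?x = "([a, b], TG c a, [b, c])" and ?z = "([], MG a, [b, b, c, c])"
    and ?m = "[([a], MG b, [c, c]), ([a, b], MG c, [])]"
  have "[?x] @ [([a], TG b a, [c, b, c]), ([a, a, b], TG c b, [c])] @ ?z # ?m \<asymp>
      [?x] @ [([a, b, a], TG c b, [c]), ([a], TG b a, [b, c, c])] @ ?z # ?m"
    by (rule slides_swap[where m = "[]"]) simp_all
  moreover have "[?x, ([a], TG b a, [c, b, c])] @ [([], MG a, [b, c, b, c]), ([a, b], TG c b, [c])] @ ?m \<asymp>
      [?x, ([a], TG b a, [c, b, c])] @ [([a, a, b], TG c b, [c]), ?z] @ ?m"
    by (rule slides_swap[where m = "[b]"]) simp_all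
  ultimately have "[?x, ([a], TG b a, [c, b, c]), ([], MG a, [b, c, b, c]), ([a, b], TG c b, [c])] @ ?m \<asymp>
      [?x, ([a, b, a], TG c b, [c]), ([a], TG b a, [b, c, c]), ?z] @ ?m"
    by (simp add: equivclp_trans)
  from equivclp_sym[OF this] show ?thesis
    by (simp add: a_def b_def c_def degen_letter_adjacent)
qed

text \<open>
  When both strands of a crossing are split, the four resulting crossings are performed row by row or
  column by column. The two orders differ in the two crossings in the middle, which are disjoint.
\<close>

lemma steps_degen_degen_swap:
  assumes "i < j"
  shows "steps (degen_term i (degen_term j (TG j i))) \<asymp> steps (degen_term (Suc j) (degen_term i (TG j i)))"
proof -
  define a a' c c' where "a = i" and "a' = Suc i" and "c = Suc j" and "c' = Suc (Suc j)"
  have "[([c], TG c' a, [a'])] @ [([], TG c a, [c', a']), ([a, c], TG c' a', [])] @ [([a], TG c a', [c'])] \<asymp>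
      [([c], TG c' a, [a'])] @ [([c, a], TG c' a', []), ([], TG c a, [a', c'])] @ [([a], TG c a', [c'])]"
    by (rule slides_swap[where m = "[]"]) simp_all
  from equivclp_sym[OF this] show ?thesis
    using assms by (simp add: a_def a'_def c_def c'_def degen_letter_degen_letter[OF assms])
qed

lemma degen_degen_term:
  assumes "wf_term k f" "i \<le> j" "j \<le> k"
  shows "(degen_term i (degen_term j f), degen_term (Suc j) (degen_term i f)) \<in> bcong (Suc (Suc k))"
proof (rule bcong_on_generatorsI[where F = "\<lambda>f. degen_term i (degen_term j f)" and
      F' = "\<lambda>f. degen_term (Suc j) (degen_term i f)" and
      k = k and V = "\<lambda>w. degen_word i (degen_word j w)"])
  consider (eq) "i = j" | (less) "i < j" using assms(2) by linarith
  then show "steps (degen_term i (degen_term j (UG a))) \<asymp> steps (degen_term (Suc j) (degen_term i (UG a)))" for a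
  proof cases
    case eq
    then show ?thesis
      by (cases "a = i") (simp_all add: degen_letter_degen_letter_same degen_letter_adjacent)
  next
    case less
    then show ?thesis
      by (cases "a = i"; cases "a = j") (simp_all add: degen_letter_degen_letter[OF less])
  qed
  consider (eq) "i = j" | (less) "i < j" using assms(2) by linarith
  then show "steps (degen_term i (degen_term j (MG a))) \<asymp> steps (degen_term (Suc j) (degen_term i (MG a)))" for a
  proof cases
    case eq
    then show ?thesis
      using steps_degen_degen_mult
      by (cases "a = i") (simp_all add: degen_letter_degen_letter_same degen_letter_adjacent
          del: degen_term.simps(3), simp add: degen_letter_degen_letter_same)
  next
    case less
    then show ?thesis
      by (cases "a = i"; cases "a = j") (simp_all add: degen_letter_degen_letter[OF less])
  qed
  consider (eq) "i = j" | (less) "i < j" using assms(2) by linarith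
  then show "steps (degen_term i (degen_term j (TG c d))) \<asymp> steps (degen_term (Suc j) (degen_term i (TG c d)))"
    if "d < c" for c d
  proof cases
    case eq
    then show ?thesis
      using that
      by (cases "c = i"; cases "d = i") (simp_all add: degen_letter_degen_letter_same degen_letter_adjacent)
  next
    case less
    show ?thesis
    proof (cases "c = j \<and> d = i")
      case True
      then show ?thesis using steps_degen_degen_swap less by blast
    next
      case False
      then show ?thesis
        using that less
        by (cases "c = i"; cases "c = j"; cases "d = i"; cases "d = j")
          (simp_all add: degen_letter_degen_letter[OF less])
    qed
  qed
  fix f assume "wf_term k f"
  then show "wf_term (Suc (Suc k)) (degen_term i (degen_term j f)) \<and>
      src (degen_term i (degen_term j f)) = degen_word i (degen_word j (src f)) \<and>
      tgt (degen_term i (degen_term j f)) = degen_word i (degen_word j (tgt f))"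
    and "wf_term (Suc (Suc k)) (degen_term (Suc j) (degen_term i f)) \<and>
      src (degen_term (Suc j) (degen_term i f)) = degen_word i (degen_word j (src f)) \<and>
      tgt (degen_term (Suc j) (degen_term i f)) = degen_word i (degen_word j (tgt f))"
    using assms degen_term_degen_term_typed[of k f i j] degen_term_degen_term_typed[of k f "Suc j" i]
    by (simp_all add: degen_word_degen_word)
qed (use assms in simp_all)

section \<open>The operad structure\<close>

definition tw_term :: "nat \<Rightarrow> nat \<Rightarrow> bterm \<Rightarrow> bool" where
  "tw_term k n f \<longleftrightarrow> wf_term k f \<and> src f = bracket_pow k n \<and> tgt f = bracket k"

abbreviation tens_list :: "bterm list \<Rightarrow> bterm" where
  "tens_list gs \<equiv> foldr (\<parallel>) gs (IdG [])"

lemma set_bracket: "set (bracket k) = {0..k}"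
  by (auto simp: bracket_def)

lemma bracket_pow_simps [simp]:
  "bracket_pow k 0 = []"
  "bracket_pow k (Suc n) = bracket k @ bracket_pow k n"
  by (simp_all add: bracket_pow_def)

lemma bracket_pow_add: "bracket_pow k (m + n) = bracket_pow k m @ bracket_pow k n"
  by (induction m) simp_all

lemma set_bracket_pow: "set (bracket_pow k n) \<subseteq> {0..k}"
  by (induction n) (auto simp: set_bracket)

lemma upt_split: "i \<le> m \<Longrightarrow> [0..<m] = [0..<i] @ [i..<m]"
  using upt_add_eq_append[of 0 i "m - i"] by simp

lemma face_word_bracket:
  assumes "i \<le> Suc k"
  shows "face_word i (bracket (Suc k)) = bracket k"
proof -
  have "[0..<Suc (Suc k)] = [0..<i] @ i # map Suc [i..<Suc k]"
    using assms upt_split[of i "Suc (Suc k)"] upt_conv_Cons[of i "Suc (Suc k)"]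
    by (simp add: map_Suc_upt del: upt_Suc)
  moreover have "face_word i w = w" if "set w \<subseteq> {..<i}" for w
    using that by (induction w) (auto simp: face_letter_def)
  moreover have "face_word i (map Suc w) = w" if "set w \<subseteq> {i..}" for w
    using that by (induction w) (auto simp: face_letter_def)
  ultimately have "face_word i [0..<Suc (Suc k)] = [0..<i] @ [i..<Suc k]"
    by (simp del: upt_Suc add: lessThan_def atLeast_def subset_eq)
  then show ?thesis
    using assms upt_split[of i "Suc k"] by (simp add: bracket_def del: upt_Suc)
qed

lemma degen_word_bracket:
  assumes "i \<le> k"
  shows "degen_word i (bracket k) = bracket (Suc k)"
proof -
  have "[0..<Suc k] = [0..<i] @ i # [Suc i..<Suc k]"
    using assms upt_split[of i "Suc k"] upt_conv_Cons[of i "Suc k"] by (simp del: upt_Suc)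
  moreover have "degen_word i w = w" if "set w \<subseteq> {..<i}" for w
    using that by (induction w) (auto simp: degen_letter_def)
  moreover have "degen_word i w = map Suc w" if "set w \<subseteq> {i<..}" for w
    using that by (induction w) (auto simp: degen_letter_def)
  ultimately have "degen_word i [0..<Suc k] = [0..<i] @ i # Suc i # map Suc [Suc i..<Suc k]"
    by (simp del: upt_Suc add: subset_eq)
  also have "\<dots> = [0..<Suc (Suc k)]"
    using assms upt_split[of i "Suc (Suc k)"] upt_conv_Cons[of i "Suc (Suc k)"]
      upt_conv_Cons[of "Suc i" "Suc (Suc k)"] by (simp add: map_Suc_upt del: upt_Suc)
  finally show ?thesis
    by (simp add: bracket_def)
qed

lemma face_word_bracket_pow: "i \<le> Suc k \<Longrightarrow> face_word i (bracket_pow (Suc k) n) = bracket_pow k n"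
  by (induction n) (simp_all add: face_word_bracket)

lemma degen_word_bracket_pow: "i \<le> k \<Longrightarrow> degen_word i (bracket_pow k n) = bracket_pow (Suc k) n"
  by (induction n) (simp_all add: degen_word_bracket)

lemma tw_term_face: "\<lbrakk>tw_term (Suc k) n f; i \<le> Suc k\<rbrakk> \<Longrightarrow> tw_term k n (face_term i f)"
  by (simp add: tw_term_def face_term_typed face_word_bracket face_word_bracket_pow)

lemma tw_term_degen: "\<lbrakk>tw_term k n f; i \<le> k\<rbrakk> \<Longrightarrow> tw_term (Suc k) n (degen_term i f)"
  by (simp add: tw_term_def degen_term_typed degen_word_bracket degen_word_bracket_pow)

lemma TW_simps [simp]:
  "face (TW n) = bface" "degen (TW n) = bdegen"
  "simplices (TW n) k = bmor_of k ` {f. tw_term k n f}"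
  by (auto simp: TW_def bhom_def tw_term_def quotient_def bmor_of_def)

lemma bface_tw [simp]:
  "\<lbrakk>tw_term (Suc k) n f; i \<le> Suc k\<rbrakk> \<Longrightarrow> bface (Suc k) i (bmor_of (Suc k) f) = bmor_of k (face_term i f)"
  by (simp add: bface_bmor_of tw_term_def)

lemma bdegen_tw [simp]:
  "\<lbrakk>tw_term k n f; i \<le> k\<rbrakk> \<Longrightarrow> bdegen k i (bmor_of k f) = bmor_of (Suc k) (degen_term i f)"
  by (simp add: bdegen_bmor_of tw_term_def)

lemma simplicial_set_TW: "simplicial_set (TW n)"
proof
  fix x k i assume "x \<in> simplices (TW n) (Suc k)" "i \<le> Suc k"
  then show "face (TW n) (Suc k) i x \<in> simplices (TW n) k"
    by (auto intro!: imageI tw_term_face)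
next
  fix x k i assume "x \<in> simplices (TW n) k" "i \<le> k"
  then show "degen (TW n) k i x \<in> simplices (TW n) (Suc k)"
    by (auto intro!: imageI tw_term_degen)
next
  fix x k i j assume "x \<in> simplices (TW n) (Suc (Suc k))" and ij: "i < j" "j \<le> Suc (Suc k)"
  then obtain f where x: "x = bmor_of (Suc (Suc k)) f" and f: "tw_term (Suc (Suc k)) n f" by auto
  obtain j' where j': "j = Suc j'" using ij by (cases j) auto
  then show "face (TW n) (Suc k) i (face (TW n) (Suc (Suc k)) j x) =
      face (TW n) (Suc k) (j - 1) (face (TW n) (Suc (Suc k)) i x)"
    using f ij tw_term_face[OF f, of i] tw_term_face[OF f, of j]
      face_term_face_term[of i j' "Suc (Suc k)" f]
    by (simp add: x tw_term_def bface_bmor_of)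
next
  fix x k i j assume "x \<in> simplices (TW n) k" and ij: "i < j" "j \<le> k"
  then obtain f where x: "x = bmor_of k f" and f: "tw_term k n f" by auto
  obtain j' k' where j': "j = Suc j'" "k = Suc k'" using ij by (cases j; cases k) auto
  have "bmor_of k (face_term i (degen_term j f)) = bmor_of k (degen_term (j - 1) (face_term i f))"
    using face_degen_term_less[of k' f i j'] f ij by (intro bmor_of_eqI) (simp add: j' tw_term_def)
  then show "face (TW n) (Suc k) i (degen (TW n) k j x) =
      degen (TW n) (k - 1) (j - 1) (face (TW n) k i x)"
    using f ij tw_term_face[of k' n f i] tw_term_degen[OF f, of j]
    by (simp add: x j')
next
  fix x k j assume "x \<in> simplices (TW n) k" and j: "j \<le> k"
  then obtain f where x: "x = bmor_of k f" and f: "tw_term k n f" by auto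
  have "bmor_of k (face_term i (degen_term j f)) = bmor_of k f" if "i = j \<or> i = Suc j" for i
    using face_degen_term_same[of k f i j] f j that by (intro bmor_of_eqI) (simp add: tw_term_def)
  then show "face (TW n) (Suc k) j (degen (TW n) k j x) = x"
    "face (TW n) (Suc k) (Suc j) (degen (TW n) k j x) = x"
    using f j tw_term_degen[OF f, of j] by (simp_all add: x)
next
  fix x k i j assume "x \<in> simplices (TW n) k" and ij: "Suc j < i" "i \<le> Suc k"
  then obtain f where x: "x = bmor_of k f" and f: "tw_term k n f" by auto
  obtain i' k' where i': "i = Suc i'" "k = Suc k'" using ij by (cases i; cases k) auto
  have "bmor_of k (face_term i (degen_term j f)) = bmor_of k (degen_term j (face_term (i - 1) f))"
    using face_degen_term_greater[of k' f j i'] f ij by (intro bmor_of_eqI) (simp add: i' tw_term_def)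
  then show "face (TW n) (Suc k) i (degen (TW n) k j x) =
      degen (TW n) (k - 1) j (face (TW n) k (i - 1) x)"
    using f ij tw_term_face[of k' n f i'] tw_term_degen[OF f, of j]
    by (simp add: x i')
next
  fix x k i j assume "x \<in> simplices (TW n) k" and ij: "i \<le> j" "j \<le> k"
  then obtain f where x: "x = bmor_of k f" and f: "tw_term k n f" by auto
  have "bmor_of (Suc (Suc k)) (degen_term i (degen_term j f)) =
      bmor_of (Suc (Suc k)) (degen_term (Suc j) (degen_term i f))"
    using degen_degen_term[of k f i j] f ij by (intro bmor_of_eqI) (simp add: tw_term_def)
  then show "degen (TW n) (Suc k) i (degen (TW n) k j x) =
      degen (TW n) (Suc k) (Suc j) (degen (TW n) k i x)"
    using f ij tw_term_degen[OF f, of i] tw_term_degen[OF f, of j] by (simp add: x)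
qed

lemma tens_list_typed:
  "list_all2 (tw_term k) ms gs \<Longrightarrow> wf_term k (tens_list gs) \<and>
    src (tens_list gs) = bracket_pow k (sum_list ms) \<and> tgt (tens_list gs) = bracket_pow k (length ms)"
  by (induction rule: list_all2_induct) (auto simp: tw_term_def bracket_pow_add)

lemma tw_term_comp:
  "\<lbrakk>tw_term k (length ms) f; list_all2 (tw_term k) ms gs\<rbrakk> \<Longrightarrow>
    tw_term k (sum_list ms) (f \<cdot> tens_list gs)"
  using tens_list_typed[of k ms gs] by (simp add: tw_term_def)

lemma foldr_btens:
  assumes "list_all2 (tw_term k) ms gs"
  shows "foldr (btens k) (map (bmor_of k) gs) (bid k []) = bmor_of k (tens_list gs)"
  using assms
proof (induction rule: list_all2_induct)
  case Nil
  then show ?case by (simp add: bid_def)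
next
  case (Cons m ms g gs)
  then show ?case
    using tens_list_typed[of k ms gs] by (simp add: tw_term_def btens_bmor_of)
qed

lemma TW_comp_bmor_of:
  assumes "tw_term k (length ms) f" "list_all2 (tw_term k) ms gs"
  shows "TW_comp ms' k (bmor_of k f) (map (bmor_of k) gs) = bmor_of k (f \<cdot> tens_list gs)"
  using assms tens_list_typed[of k ms gs]
  by (simp add: TW_comp_def foldr_btens bcomp_bmor_of tw_term_def)

lemma list_all2_TW_simplexE:
  assumes "list_all2 (\<lambda>m G. G \<in> simplices (TW (h m)) k) ms Gs"
  obtains gs where "Gs = map (bmor_of k) gs" "list_all2 (\<lambda>m. tw_term k (h m)) ms gs"
proof -
  have "\<exists>gs. Gs = map (bmor_of k) gs \<and> list_all2 (\<lambda>m. tw_term k (h m)) ms gs"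
    using assms
  proof (induction rule: list_all2_induct)
    case (Cons m ms G Gs)
    then obtain g gs where "G # Gs = map (bmor_of k) (g # gs)" "list_all2 (\<lambda>m. tw_term k (h m)) (m # ms) (g # gs)"
      by auto
    then show ?case by metis
  qed simp
  then show ?thesis using that by blast
qed

lemma TW_comp_argumentsE:
  assumes "F \<in> simplices (TW n) k" "list_all2 (\<lambda>m G. G \<in> simplices (TW (h m)) k) ms Gs"
  obtains f gs where "F = bmor_of k f" "tw_term k n f"
    "Gs = map (bmor_of k) gs" "list_all2 (\<lambda>m. tw_term k (h m)) ms gs"
  using assms(1) list_all2_TW_simplexE[OF assms(2)] by fastforce

lemma bcong_tens_list_append:
  assumes "\<forall>g \<in> set gs \<union> set hs. wf_term k g"
  shows "(tens_list (gs @ hs), tens_list gs \<parallel> tens_list hs) \<in> bcong k"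
proof -
  have wf: "wf_term k (tens_list xs)" if "\<forall>g \<in> set xs. wf_term k g" for xs
    using that by (induction xs) auto
  have wf_hs: "wf_term k (tens_list hs)" using wf assms by simp
  show ?thesis
    using assms
  proof (induction gs)
    case Nil
    then show ?case using wf_hs by (simp add: bcong.sym[OF bcong.Tens_unit_left])
  next
    case (Cons g gs)
    then have g: "wf_term k g" "wf_term k (tens_list gs)" using wf by simp_all
    have "(g \<parallel> tens_list (gs @ hs), g \<parallel> (tens_list gs \<parallel> tens_list hs)) \<in> bcong k"
      using Cons g by (intro bcong.Tens_cong bcong.refl) simp_all
    also have "(g \<parallel> (tens_list gs \<parallel> tens_list hs), (g \<parallel> tens_list gs) \<parallel> tens_list hs) \<in> bcong k"
      using g wf_hs by (rule bcong_Tens_assoc')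
    finally show ?case by simp
  qed
qed

lemma list_all2_tw_wf: "list_all2 (tw_term k) ms gs \<Longrightarrow> \<forall>g \<in> set gs. wf_term k g"
  by (auto simp: list_all2_conv_all_nth in_set_conv_nth tw_term_def)

text \<open>
  Associativity of the operad composition is the interchange law applied to \<open>n\<close> factors at once. The
  typing statements are part of the induction because each step needs the interfaces of the tails.
\<close>

lemma bcong_tens_list_comp:
  assumes "list_all2 (\<lambda>ps g. tw_term k (length ps) g) pss gs"
    "list_all2 (list_all2 (tw_term k)) pss hss"
  shows "(tens_list gs \<cdot> tens_list (concat hss), tens_list (map2 (\<lambda>g hs. g \<cdot> tens_list hs) gs hss)) \<in> bcong k
    \<and> list_all2 (tw_term k) (concat pss) (concat hss) \<and> list_all2 (tw_term k) (map length pss) gs"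
  using assms
proof (induction arbitrary: hss rule: list_all2_induct)
  case Nil
  then show ?case by (simp add: bcong_Id_left)
next
  case (Cons ps pss g gs)
  from Cons.prems obtain hs hss' where hss: "hss = hs # hss'"
    and hs: "list_all2 (tw_term k) ps hs" and hss': "list_all2 (list_all2 (tw_term k)) pss hss'"
    by (auto simp: list_all2_Cons1)
  have IH: "(tens_list gs \<cdot> tens_list (concat hss'), tens_list (map2 (\<lambda>g hs. g \<cdot> tens_list hs) gs hss')) \<in> bcong k"
    and c: "list_all2 (tw_term k) (concat pss) (concat hss')" and gs: "list_all2 (tw_term k) (map length pss) gs"
    using Cons.IH[OF hss'] by auto
  note t = tens_list_typed[OF hs] tens_list_typed[OF c] tens_list_typed[OF gs]
  have g: "wf_term k g" "src g = bracket_pow k (length ps)" using Cons.hyps by (auto simp: tw_term_def)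
  have len: "length (concat pss) = sum_list (map length pss)" by (simp add: length_concat)
  have A: "(tens_list (hs @ concat hss'), tens_list hs \<parallel> tens_list (concat hss')) \<in> bcong k"
    using list_all2_tw_wf[OF hs] list_all2_tw_wf[OF c] by (intro bcong_tens_list_append) auto
  have B: "((g \<parallel> tens_list gs) \<cdot> (tens_list hs \<parallel> tens_list (concat hss')),
      (g \<cdot> tens_list hs) \<parallel> tens_list (map2 (\<lambda>g hs. g \<cdot> tens_list hs) gs hss')) \<in> bcong k"
    by (rule bcong_Tens_Comp[OF bcong.refl IH]) (use g t in simp)
  have "list_all2 (tw_term k) (concat (ps # pss)) (concat (hs # hss'))"
    using hs c by (simp add: list_all2_appendI)
  then show ?case
    using bcong_Comp_right[OF A B] gs Cons.hyps(1) by (simp add: hss)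
qed

lemma bcong_tens_list_Id:
  "(tens_list (replicate n (IdG (bracket k))), IdG (bracket_pow k n)) \<in> bcong k"
proof (induction n)
  case (Suc n)
  have "(IdG (bracket k) \<parallel> tens_list (replicate n (IdG (bracket k))),
      IdG (bracket k) \<parallel> IdG (bracket_pow k n)) \<in> bcong k"
    using Suc by (intro bcong.Tens_cong bcong.refl) (simp add: set_bracket)
  also have "(IdG (bracket k) \<parallel> IdG (bracket_pow k n), IdG (bracket k @ bracket_pow k n)) \<in> bcong k"
    by (intro bcong.Tens_Id) (simp_all add: set_bracket set_bracket_pow)
  finally show ?case by simp
qed (simp add: bcong.refl)

lemma face_tens_list: "face_term i (tens_list gs) = tens_list (map (face_term i) gs)"
  by (induction gs) simp_all

lemma degen_tens_list: "degen_term i (tens_list gs) = tens_list (map (degen_term i) gs)"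
  by (induction gs) simp_all

lemma tw_term_Id: "tw_term k 1 (IdG (bracket k))"
  by (simp add: tw_term_def set_bracket)

lemma ns_operad_TW: "ns_operad TW TW_comp TW_unit"
proof (rule ns_operad.intro)
  show "simplicial_set (TW n)" for n by (rule simplicial_set_TW)
next
  fix F ms k Gs
  assume "F \<in> simplices (TW (length ms)) k" and "list_all2 (\<lambda>m G. G \<in> simplices (TW m) k) ms Gs"
  then obtain f gs where "F = bmor_of k f" "tw_term k (length ms) f"
    "Gs = map (bmor_of k) gs" "list_all2 (tw_term k) ms gs"
    by (rule TW_comp_argumentsE)
  then show "TW_comp ms k F Gs \<in> simplices (TW (sum_list ms)) k"
    by (auto simp: TW_comp_bmor_of intro!: imageI tw_term_comp)
next
  fix F ms k Gs i
  assume "F \<in> simplices (TW (length ms)) (Suc k)"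
    "list_all2 (\<lambda>m G. G \<in> simplices (TW m) (Suc k)) ms Gs" and i: "i \<le> Suc k"
  then obtain f gs where F: "F = bmor_of (Suc k) f" and f: "tw_term (Suc k) (length ms) f"
    and Gs: "Gs = map (bmor_of (Suc k)) gs" and gs: "list_all2 (tw_term (Suc k)) ms gs"
    by - (rule TW_comp_argumentsE)
  have "map2 (\<lambda>m g. face (TW m) (Suc k) i g) ms Gs = map (bmor_of k) (map (face_term i) gs)"
    using gs unfolding Gs by (induction rule: list_all2_induct) (use i in auto)
  moreover have "list_all2 (tw_term k) ms (map (face_term i) gs)"
    using gs tw_term_face i by (auto simp: list_all2_conv_all_nth)
  ultimately show "face (TW (sum_list ms)) (Suc k) i (TW_comp ms (Suc k) F Gs) =
      TW_comp ms k (face (TW (length ms)) (Suc k) i F) (map2 (\<lambda>m g. face (TW m) (Suc k) i g) ms Gs)"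
    using f gs i tw_term_comp[OF f gs] tw_term_face[OF f i]
    by (simp add: F Gs TW_comp_bmor_of face_tens_list del: map_map)
next
  fix F ms k Gs i
  assume "F \<in> simplices (TW (length ms)) k"
    "list_all2 (\<lambda>m G. G \<in> simplices (TW m) k) ms Gs" and i: "i \<le> k"
  then obtain f gs where F: "F = bmor_of k f" and f: "tw_term k (length ms) f"
    and Gs: "Gs = map (bmor_of k) gs" and gs: "list_all2 (tw_term k) ms gs"
    by - (rule TW_comp_argumentsE)
  have "map2 (\<lambda>m g. degen (TW m) k i g) ms Gs = map (bmor_of (Suc k)) (map (degen_term i) gs)"
    using gs unfolding Gs by (induction rule: list_all2_induct) (use i in auto)
  moreover have "list_all2 (tw_term (Suc k)) ms (map (degen_term i) gs)"
    using gs tw_term_degen i by (auto simp: list_all2_conv_all_nth)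
  ultimately show "degen (TW (sum_list ms)) k i (TW_comp ms k F Gs) =
      TW_comp ms (Suc k) (degen (TW (length ms)) k i F) (map2 (\<lambda>m g. degen (TW m) k i g) ms Gs)"
    using f gs i tw_term_comp[OF f gs] tw_term_degen[OF f i]
    by (simp add: F Gs TW_comp_bmor_of degen_tens_list del: map_map)
next
  show "TW_unit k \<in> simplices (TW 1) k" for k
    using tw_term_Id by (auto simp: TW_unit_def bid_def)
  show "face (TW 1) (Suc k) i (TW_unit (Suc k)) = TW_unit k" if "i \<le> Suc k" for i k
    using that bface_tw[OF tw_term_Id] by (simp add: TW_unit_def bid_def face_word_bracket)
  show "degen (TW 1) k i (TW_unit k) = TW_unit (Suc k)" if "i \<le> k" for i k
    using that bdegen_tw[OF tw_term_Id] by (simp add: TW_unit_def bid_def degen_word_bracket)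
next
  fix F n k assume "F \<in> simplices (TW n) k"
  then obtain f where F: "F = bmor_of k f" and f: "tw_term k n f" by auto
  have "(IdG (bracket k) \<cdot> tens_list [f], f) \<in> bcong k"
    using f bcong_Comp_right[OF bcong.Tens_unit_right bcong_Id_left] by (simp add: tw_term_def)
  then show "TW_comp [n] k (TW_unit k) [F] = F"
    using f TW_comp_bmor_of[of k "[n]" "IdG (bracket k)" "[f]" "[n]"] tw_term_Id
    by (simp add: F TW_unit_def bid_def bmor_of_eqI)
  have "(f \<cdot> tens_list (replicate n (IdG (bracket k))), f) \<in> bcong k"
    using f bcong.Id_right[of k f] by (intro bcong_Comp_right[OF bcong_tens_list_Id]) (simp add: tw_term_def)
  moreover have "list_all2 (tw_term k) (replicate n 1) (replicate n (IdG (bracket k)))"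
    using tw_term_Id by (simp add: list_all2_conv_all_nth)
  ultimately show "TW_comp (replicate n 1) k F (replicate n (TW_unit k)) = F"
    using f TW_comp_bmor_of[of k "replicate n 1" f "replicate n (IdG (bracket k))"]
    by (simp add: F TW_unit_def bid_def bmor_of_eqI)
next
  fix F pss k Gs Hss
  assume FG: "F \<in> simplices (TW (length pss)) k"
    "list_all2 (\<lambda>ps G. G \<in> simplices (TW (length ps)) k) pss Gs"
    and H: "list_all2 (list_all2 (\<lambda>p H. H \<in> simplices (TW p) k)) pss Hss"
  obtain f gs where F: "F = bmor_of k f" and f: "tw_term k (length pss) f"
    and Gs: "Gs = map (bmor_of k) gs" and gs: "list_all2 (\<lambda>ps. tw_term k (length ps)) pss gs"
    using FG by (rule TW_comp_argumentsE)
  from H have "\<exists>hss. Hss = map (map (bmor_of k)) hss \<and> list_all2 (list_all2 (tw_term k)) pss hss"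
  proof (induction rule: list_all2_induct)
    case (Cons ps pss Hs Hss)
    obtain hs where "Hs = map (bmor_of k) hs" "list_all2 (tw_term k) ps hs"
      using list_all2_TW_simplexE[OF Cons.hyps(1)] by blast
    with Cons.IH obtain hss where "Hs # Hss = map (map (bmor_of k)) (hs # hss)"
      "list_all2 (list_all2 (tw_term k)) (ps # pss) (hs # hss)"
      by auto
    then show ?case by metis
  qed simp
  then obtain hss where Hss: "Hss = map (map (bmor_of k)) hss"
    and hss: "list_all2 (list_all2 (tw_term k)) pss hss" by blast
  let ?ghs = "map2 (\<lambda>g hs. g \<cdot> tens_list hs) gs hss"
  note c = bcong_tens_list_comp[OF gs hss]
  have map: "map (\<lambda>(ps, g, hs). TW_comp ps k g hs) (zip pss (zip Gs Hss)) = map (bmor_of k) ?ghs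
      \<and> list_all2 (tw_term k) (map sum_list pss) ?ghs"
    using gs hss unfolding Gs Hss
  proof (induction arbitrary: hss rule: list_all2_induct)
    case (Cons ps pss g gs)
    then show ?case
      using TW_comp_bmor_of tw_term_comp by (auto simp: list_all2_Cons1)
  qed simp
  have fg: "tw_term k (sum_list (map length pss)) (f \<cdot> tens_list gs)"
    using tw_term_comp[of k "map length pss" f gs] f c by simp
  have "TW_comp (concat pss) k (TW_comp (map length pss) k F Gs) (concat Hss)
      = bmor_of k ((f \<cdot> tens_list gs) \<cdot> tens_list (concat hss))"
    using f fg c TW_comp_bmor_of[of k "map length pss" f gs]
      TW_comp_bmor_of[of k "concat pss" "f \<cdot> tens_list gs" "concat hss"]
    by (simp add: F Gs Hss map_concat length_concat)
  also have "\<dots> = bmor_of k (f \<cdot> tens_list ?ghs)"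
  proof (rule bmor_of_eqI, rule bcong_Comp_Comp)
    show "(tens_list gs \<cdot> tens_list (concat hss), tens_list ?ghs) \<in> bcong k" using c by simp
    show "(f \<cdot> tens_list ?ghs, f \<cdot> tens_list ?ghs) \<in> bcong k"
      using tw_term_comp[of k "map sum_list pss" f ?ghs] f map by (intro bcong.refl) (simp add: tw_term_def)
  qed
  also have "\<dots> = TW_comp (map sum_list pss) k F (map (\<lambda>(ps, g, hs). TW_comp ps k g hs) (zip pss (zip Gs Hss)))"
    using f map TW_comp_bmor_of[of k "map sum_list pss" f ?ghs] by (simp add: F del: map_map)
  finally show "TW_comp (concat pss) k (TW_comp (map length pss) k F Gs) (concat Hss) =
      TW_comp (map sum_list pss) k F (map (\<lambda>(ps, g, hs). TW_comp ps k g hs) (zip pss (zip Gs Hss)))" .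
qed

section \<open>The extra degeneracy on terms\<close>

lemma slides_append:
  assumes "xs \<asymp> ys"
  shows "as @ xs @ bs \<asymp> as @ ys @ bs"
  using assms
proof (induction rule: equivclp_induct)
  case (step y z)
  have "slide (as @ p @ bs) (as @ q @ bs)" if pq: "slide p q" for p q
    using pq
  proof cases
    case (1 xs l G m H r ys)
    show ?thesis
      using slide.intros[of "as @ xs" l G m H r "ys @ bs"] unfolding 1 by simp
  qed
  with step.hyps(2) have "slide (as @ y @ bs) (as @ z @ bs) \<or> slide (as @ z @ bs) (as @ y @ bs)"
    by blast
  with step.IH show ?case by (rule equivclp_into_equivclp)
qed simp

lemma slides_whisk:
  assumes "xs \<asymp> ys"
  shows "map (whisk a b) xs \<asymp> map (whisk a b) ys"
  using assms
proof (induction rule: equivclp_induct)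
  case (step y z)
  have "slide (map (whisk a b) p) (map (whisk a b) q)" if pq: "slide p q" for p q
    using pq
  proof cases
    case (1 xs l G m H r ys)
    show ?thesis
      using slide.intros[of "map (whisk a b) xs" "a @ l" G m H "r @ b" "map (whisk a b) ys"]
      unfolding 1 by simp
  qed
  with step.hyps(2) have "slide (map (whisk a b) y) (map (whisk a b) z) \<or>
      slide (map (whisk a b) z) (map (whisk a b) y)"
    by blast
  with step.IH show ?case by (rule equivclp_into_equivclp)
qed simp

text \<open>
  Transitivity with side equations, so that lists of steps need only match after simplification.
\<close>

lemma slides_chain:
  "\<lbrakk>xs \<asymp> ys; xs' \<asymp> ys'; ys = xs'; as = xs; bs = ys'\<rbrakk> \<Longrightarrow> as \<asymp> bs"
  by (auto intro: equivclp_trans)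

text \<open>
  A generator at the far left slides past a whole diagram to its right.
\<close>

lemma slides_past:
  assumes "typed_steps k v xs w"
  shows "([], G, v) # map (whisk (tgt G) []) xs \<asymp> map (whisk (src G) []) xs @ [([], G, w)]"
  using assms
proof (induction xs arbitrary: v)
  case (Cons s xs)
  obtain l H r where s: "s = (l, H, r)" by (cases s)
  let ?u = "l @ tgt H @ r"
  have v: "v = l @ src H @ r" and t: "typed_steps k ?u xs w" using Cons.prems s by auto
  have "[] @ [([], G, v), (tgt G @ l, H, r)] @ map (whisk (tgt G) []) xs \<asymp>
      [] @ [(src G @ l, H, r), ([], G, ?u)] @ map (whisk (tgt G) []) xs"
    by (rule slides_swap[where m = l]) (simp_all add: v)
  moreover have "[(src G @ l, H, r)] @ (([], G, ?u) # map (whisk (tgt G) []) xs) @ [] \<asymp>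
      [(src G @ l, H, r)] @ (map (whisk (src G) []) xs @ [([], G, w)]) @ []"
    by (rule slides_append[OF Cons.IH[OF t]])
  ultimately show ?case
    by (rule slides_chain) (simp_all add: s)
qed simp

text \<open>
  The embedding of \<open>\<B>_k\<close> into \<open>\<B>_{k+1}\<close> that frees the letter \<open>0\<close>.
\<close>

primrec shift_term :: "bterm \<Rightarrow> bterm" where
  "shift_term (IdG w) = IdG (map Suc w)"
| "shift_term (UG a) = UG (Suc a)"
| "shift_term (MG a) = MG (Suc a)"
| "shift_term (TG c d) = TG (Suc c) (Suc d)"
| "shift_term (f \<cdot> g) = shift_term f \<cdot> shift_term g"
| "shift_term (f \<parallel> g) = shift_term f \<parallel> shift_term g"

lemma shift_term_typed:
  "wf_term k f \<Longrightarrow> wf_term (Suc k) (shift_term f) \<and>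
    src (shift_term f) = map Suc (src f) \<and> tgt (shift_term f) = map Suc (tgt f)"
  by (induction f) auto

lemma set_map_Suc: "set w \<subseteq> {0..k} \<Longrightarrow> set (map Suc w) \<subseteq> {0..Suc k}"
  by auto

lemma shift_term_bcong:
  "(f, g) \<in> bcong k \<Longrightarrow> (shift_term f, shift_term g) \<in> bcong (Suc k)"
proof (induction rule: bcong.induct)
  case (sym f g)
  from sym.IH show ?case by (rule bcong.sym)
next
  case (trans f g h)
  from trans.IH show ?case by (rule bcong.trans)
next
  case (Comp_cong f f' g g')
  from Comp_cong.hyps(1,2)[THEN bcong_typed] Comp_cong.IH Comp_cong.hyps show ?case
    by (auto intro!: bcong.Comp_cong simp: shift_term_typed[of k])
next
  case (Id_left f)
  then show ?case using shift_term_typed[of k f] by (simp add: bcong_Id_left)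
next
  case (Id_right f)
  then show ?case using shift_term_typed[of k f] bcong.Id_right[of "Suc k" "shift_term f"] by simp
next
  case (Tens_Id v w)
  then show ?case using set_map_Suc by (simp add: bcong.Tens_Id del: set_map)
qed (simp_all add: shift_term_typed bcong.refl bcong.Tens_cong bcong.Comp_assoc bcong.Tens_assoc
      bcong.Tens_unit_left bcong.Tens_unit_right bcong.interchange bcong.mult_unit_right
      bcong.mult_unit_left bcong.swap_unit_right bcong.swap_unit_left)

lemma face_letter_Suc: "face_letter (Suc i) (Suc a) = Suc (face_letter i a)" if "a \<noteq> i"
  using that by (auto simp: face_letter_def)

lemma face_letter_0: "face_letter 0 a = a - 1" "face_letter (Suc i) 0 = 0"
  by (auto simp: face_letter_def)

lemma degen_letter_Suc: "degen_letter (Suc i) (Suc a) = Suc (degen_letter i a)"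
  by (auto simp: degen_letter_def)

lemma degen_letter_0: "degen_letter (Suc i) 0 = 0"
  by (auto simp: degen_letter_def)

lemma face_word_map_Suc:
  "face_word 0 (map Suc w) = w" "face_word (Suc i) (map Suc w) = map Suc (face_word i w)"
  by (induction w) (auto simp: face_letter_0 face_letter_Suc)

lemma degen_word_map_Suc: "degen_word (Suc i) (map Suc w) = map Suc (degen_word i w)"
  by (induction w) (auto simp: degen_letter_Suc)

lemma face_term_shift_term:
  "face_term 0 (shift_term f) = f"
  "wf_term k f \<Longrightarrow> face_term (Suc i) (shift_term f) = shift_term (face_term i f)"
  by (induction f) (auto simp: face_letter_0 face_letter_Suc face_word_map_Suc)

lemma degen_term_shift_term: "degen_term (Suc i) (shift_term f) = shift_term (degen_term i f)"
  by (induction f) (auto simp: degen_letter_Suc degen_word_map_Suc)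

text \<open>
  Erasing the only letter leaves nothing; this is why \<open>d_1 e(f)\<close> does not depend on the vertex \<open>f\<close>.
\<close>

lemma steps_face_term_only_letter: "wf_term 0 f \<Longrightarrow> steps (face_term 0 f) = []"
  by (induction f) auto

text \<open>
  One choice of an \<open>n\<close>-fold product \<open>(0)\<^sup>n \<rightarrow> (0)\<close>. Since \<open>m\<^sup>0\<close> is not associative, different
  bracketings give different morphisms; any fixed one serves as the apex of all cones.
\<close>

primrec mult_all :: "nat \<Rightarrow> bterm" where
  "mult_all 0 = UG 0"
| "mult_all (Suc n) = MG 0 \<cdot> (IdG [0] \<parallel> mult_all n)"

lemma mult_all_typed:
  "wf_term k (mult_all n) \<and> src (mult_all n) = replicate n 0 \<and> tgt (mult_all n) = [0]"
  by (induction n) auto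

lemma face_mult_all:
  "face_term (Suc i) (mult_all n) = mult_all n" "steps (face_term 0 (mult_all n)) = []"
  by (induction n) (simp_all add: face_letter_0)

lemma degen_mult_all: "degen_term (Suc i) (mult_all n) = mult_all n"
  by (induction n) (simp_all add: degen_letter_0)

text \<open>
  The crossing \<open>(c) \<squnion> (0)\<^sup>m \<rightarrow> (0)\<^sup>m \<squnion> (c)\<close> of one letter with a block of zeros.
\<close>

primrec carry :: "nat \<Rightarrow> nat \<Rightarrow> bterm" where
  "carry c 0 = IdG [c]"
| "carry c (Suc m) = (IdG [0] \<parallel> carry c m) \<cdot> (TG c 0 \<parallel> IdG (replicate m 0))"

lemma carry_typed:
  "\<lbrakk>0 < c; c \<le> k\<rbrakk> \<Longrightarrow> wf_term k (carry c m) \<and>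
    src (carry c m) = c # replicate m 0 \<and> tgt (carry c m) = replicate m 0 @ [c]"
  by (induction m) (auto simp: replicate_append_same[symmetric])

lemma face_word_zeros: "face_word (Suc i) (replicate m 0) = replicate m 0" "face_word 0 (replicate m 0) = []"
  by (induction m) (auto simp: face_letter_0)

lemma degen_word_zeros: "degen_word (Suc i) (replicate m 0) = replicate m 0"
  by (induction m) (auto simp: degen_letter_0)

lemma face_carry:
  "c \<noteq> Suc i \<Longrightarrow> face_term (Suc i) (carry c m) = carry (face_letter (Suc i) c) m"
  "steps (face_term (Suc i) (carry (Suc i) m)) = []"
  "steps (face_term 0 (carry c m)) = []"
  by (induction m) (auto simp: face_letter_0 face_word_zeros)

lemma degen_carry:
  "c \<noteq> Suc i \<Longrightarrow> degen_term (Suc i) (carry c m) = carry (degen_letter (Suc i) c) m"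
  by (induction m) (auto simp: degen_letter_0 degen_word_zeros)

text \<open>
  Splitting \<open>c\<close> into \<open>c, c + 1\<close> yields crossings that alternate between the two strands, zero by zero.
  On the right-hand side the strand \<open>c + 1\<close> crosses all zeros before \<open>c\<close> crosses any. In the induction,
  the first crossing of \<open>c\<close> slides past the remaining crossings of \<open>c + 1\<close>.
\<close>

lemma steps_degen_carry:
  fixes i defines "c \<equiv> Suc i"
  shows "steps (degen_term c (carry c m)) \<asymp>
    map (whisk [c] []) (steps (carry (Suc c) m)) @ map (whisk [] [Suc c]) (steps (carry c m))"
proof (induction m)
  case (Suc m)
  let ?P = "steps (carry (Suc c) m)" and ?Q = "steps (carry c m)"
  let ?z = "replicate m (0::nat)"
  have carry: "typed_steps (Suc c) (Suc c # ?z) ?P (?z @ [Suc c])"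
    using bcong_run_steps[of "Suc c" "carry (Suc c) m"] carry_typed[of "Suc c" "Suc c" m] by simp
  have "[([c], TG (Suc c) 0, ?z), ([], TG c 0, Suc c # ?z)] @
        map (whisk [0] []) (steps (degen_term c (carry c m))) @ [] \<asymp>
      [([c], TG (Suc c) 0, ?z), ([], TG c 0, Suc c # ?z)] @
        map (whisk [0] []) (map (whisk [c] []) ?P @ map (whisk [] [Suc c]) ?Q) @ []"
    by (intro slides_append slides_whisk Suc.IH)
  moreover have "[([c], TG (Suc c) 0, ?z)] @
        (([], TG c 0, Suc c # ?z) # map (whisk (tgt (TG c 0)) []) ?P) @ map (whisk [0] [Suc c]) ?Q \<asymp>
      [([c], TG (Suc c) 0, ?z)] @
        (map (whisk (src (TG c 0)) []) ?P @ [([], TG c 0, ?z @ [Suc c])]) @ map (whisk [0] [Suc c]) ?Q"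
    by (intro slides_append slides_past[OF carry])
  ultimately show ?case
    by (rule slides_chain) (simp_all add: comp_def c_def degen_letter_0 degen_word_zeros)
qed (simp add: c_def)

text \<open>
  The morphism that moves all zeros of a word to the left. It is defined for arbitrary words,
  so that its compatibility with faces and degeneracies can be proved by induction on the word.
\<close>

primrec sift :: "word \<Rightarrow> bterm" where
  "sift [] = IdG []"
| "sift (a # w) = (if a = 0 then IdG [0] \<parallel> sift w
    else (carry a (count_list w 0) \<parallel> IdG (filter ((<) 0) w)) \<cdot> (IdG [a] \<parallel> sift w))"

lemma sift_typed:
  "set w \<subseteq> {0..k} \<Longrightarrow> wf_term k (sift w) \<and> src (sift w) = w \<and>
    tgt (sift w) = replicate (count_list w 0) 0 @ filter ((<) 0) w"
  by (induction w) (auto simp: carry_typed)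

lemma count_list_face_word: "count_list (face_word (Suc i) w) 0 = count_list w 0"
  by (induction w) (auto simp: face_letter_def)

lemma filter_face_word:
  "filter ((<) 0) (face_word (Suc i) w) = face_word (Suc i) (filter ((<) 0) w)"
  by (induction w) (auto simp: face_letter_def)

lemma count_list_degen_word: "count_list (degen_word (Suc i) w) 0 = count_list w 0"
  by (induction w) (auto simp: degen_letter_def)

lemma filter_degen_word:
  "filter ((<) 0) (degen_word (Suc i) w) = degen_word (Suc i) (filter ((<) 0) w)"
  by (induction w) (auto simp: degen_letter_def)

lemma steps_face_sift: "steps (face_term (Suc i) (sift w)) = steps (sift (face_word (Suc i) w))"
proof (induction w)
  case (Cons a w)
  consider "a = 0" | "a = Suc i" | "a \<noteq> 0" "a \<noteq> Suc i" by blast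
  then show ?case
  proof cases
    case 3
    then have "face_letter (Suc i) a \<noteq> 0" by (auto simp: face_letter_def)
    with 3 Cons show ?thesis
      by (simp add: face_carry count_list_face_word filter_face_word)
  qed (use Cons in \<open>simp_all add: face_letter_0 face_carry\<close>)
qed simp

lemma steps_face_zero_sift: "steps (face_term 0 (sift w)) = []"
  by (induction w) (auto simp: face_carry)

text \<open>
  The only letter at which the two sides differ as terms is the one being split, where
  \<open>steps_degen_carry\<close> applies.
\<close>

lemma steps_degen_sift: "steps (degen_term (Suc i) (sift w)) \<asymp> steps (sift (degen_word (Suc i) w))"
proof (induction w)
  case (Cons a w)
  let ?n = "count_list w 0" and ?nz = "degen_word (Suc i) (filter ((<) 0) w)"
  note IH = Cons.IH
  consider "a = 0" | "a = Suc i" | "a \<noteq> 0" "a \<noteq> Suc i" by blast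
  then show ?case
  proof cases
    case 1
    then show ?thesis
      using slides_whisk[OF IH] by (simp add: degen_letter_0)
  next
    case 2
    let ?c = "Suc i"
    have "[] @ map (whisk [?c, Suc ?c] []) (steps (degen_term ?c (sift w))) @
          map (whisk [] ?nz) (steps (degen_term ?c (carry ?c ?n))) \<asymp>
        [] @ map (whisk [?c, Suc ?c] []) (steps (sift (degen_word ?c w))) @
          map (whisk [] ?nz) (steps (degen_term ?c (carry ?c ?n)))"
      by (intro slides_append slides_whisk IH)
    moreover have "map (whisk [?c, Suc ?c] []) (steps (sift (degen_word ?c w))) @
          map (whisk [] ?nz) (steps (degen_term ?c (carry ?c ?n))) @ [] \<asymp>
        map (whisk [?c, Suc ?c] []) (steps (sift (degen_word ?c w))) @
          map (whisk [] ?nz) (map (whisk [?c] []) (steps (carry (Suc ?c) ?n)) @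
            map (whisk [] [Suc ?c]) (steps (carry ?c ?n))) @ []"
      by (intro slides_append slides_whisk steps_degen_carry)
    ultimately show ?thesis
      by (rule slides_chain) (use 2 in \<open>simp_all add: count_list_degen_word filter_degen_word comp_def\<close>)
  next
    case 3
    then have "degen_letter (Suc i) a \<noteq> 0" by (auto simp: degen_letter_def)
    with 3 show ?thesis
      using slides_append[OF slides_whisk[OF IH], of "[]" "[degen_letter (Suc i) a]" "[]"
        "map (whisk [] ?nz) (steps (carry (degen_letter (Suc i) a) ?n))"]
      by (simp add: degen_carry count_list_degen_word filter_degen_word)
  qed
qed simp

text \<open>
  The morphism \<open>(\<mu> \<squnion> f') \<circ> \<sigma>\<close>.
\<close>

definition cone_term :: "nat \<Rightarrow> nat \<Rightarrow> bterm \<Rightarrow> bterm" where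
  "cone_term n k f = (mult_all n \<parallel> shift_term f) \<cdot> sift (bracket_pow (Suc k) n)"

lemma bracket_Suc: "bracket (Suc k) = 0 # map Suc (bracket k)"
  unfolding bracket_def using upt_conv_Cons[of 0 "Suc (Suc k)"] map_Suc_upt[of 0 "Suc k"]
  by (simp del: upt_Suc)

lemma sift_bracket_pow_typed:
  "wf_term (Suc k) (sift (bracket_pow (Suc k) n)) \<and>
    src (sift (bracket_pow (Suc k) n)) = bracket_pow (Suc k) n \<and>
    tgt (sift (bracket_pow (Suc k) n)) = replicate n 0 @ map Suc (bracket_pow k n)"
proof -
  have "count_list (map Suc w) 0 = 0" "filter ((<) 0) (map Suc w) = map Suc w" for w
    by (induction w) auto
  then have "count_list (bracket_pow (Suc k) n) 0 = n"
    "filter ((<) 0) (bracket_pow (Suc k) n) = map Suc (bracket_pow k n)"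
    by (induction n) (simp_all add: bracket_Suc)
  then show ?thesis
    using sift_typed[OF set_bracket_pow] by simp
qed

lemma tw_term_cone: "tw_term k n f \<Longrightarrow> tw_term (Suc k) n (cone_term n k f)"
  using sift_bracket_pow_typed[of k n] mult_all_typed[of "Suc k" n] shift_term_typed[of k f]
  by (simp add: tw_term_def cone_term_def bracket_Suc)

lemma tw_term_bcong_slidesI:
  "\<lbrakk>tw_term k n f; tw_term k n g; steps f \<asymp> steps g\<rbrakk> \<Longrightarrow> (f, g) \<in> bcong k"
  by (rule bcong_slidesI) (simp_all add: tw_term_def)

lemma face_zero_cone:
  assumes "tw_term k n f"
  shows "(face_term 0 (cone_term n k f), f) \<in> bcong k"
  using assms tw_term_face[OF tw_term_cone[OF assms], of 0] mult_all_typed[of "Suc k" n]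
  by (intro tw_term_bcong_slidesI[of k n])
    (simp_all add: cone_term_def face_mult_all steps_face_zero_sift face_term_shift_term
      face_term_typed[of 0 k "mult_all n"])

lemma face_Suc_cone:
  assumes "tw_term (Suc k) n f" "i \<le> Suc k"
  shows "(face_term (Suc i) (cone_term n (Suc k) f), cone_term n k (face_term i f)) \<in> bcong (Suc k)"
proof (rule tw_term_bcong_slidesI[of "Suc k" n])
  have "steps (face_term (Suc i) (sift (bracket_pow (Suc (Suc k)) n))) = steps (sift (bracket_pow (Suc k) n))"
    using assms(2) face_word_bracket_pow[of "Suc i" "Suc k" n]
    by (simp add: steps_face_sift)
  then show "steps (face_term (Suc i) (cone_term n (Suc k) f)) \<asymp> steps (cone_term n k (face_term i f))"
    using assms face_term_shift_term(2)[of "Suc k" f i]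
    by (simp add: cone_term_def face_mult_all tw_term_def)
qed (use assms in \<open>simp_all add: tw_term_cone tw_term_face\<close>)

lemma tw_term_mult_all: "tw_term 0 n (mult_all n)"
proof -
  have "bracket_pow 0 n = replicate n 0"
    by (induction n) (simp_all add: bracket_def)
  then show ?thesis
    using mult_all_typed[of 0 n] by (simp add: tw_term_def bracket_def)
qed

lemma face_one_cone_vertex:
  assumes "tw_term 0 n f"
  shows "(face_term 1 (cone_term n 0 f), mult_all n) \<in> bcong 0"
proof -
  have b: "bracket_pow 0 n = replicate n 0"
    by (induction n) (simp_all add: bracket_def)
  have "steps (face_term 1 (sift (bracket_pow 1 n))) = steps (sift (replicate n 0))"
    using face_word_bracket_pow[of 1 0 n] steps_face_sift[of 0 "bracket_pow 1 n"]
    by (simp add: b)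
  also have "\<dots> = []"
    by (induction n) simp_all
  finally have s: "steps (face_term 1 (sift (bracket_pow 1 n))) = []" .
  have f: "steps (face_term 1 (shift_term f)) = []" "src (face_term 1 (shift_term f)) = []"
  proof -
    have t: "wf_term 0 f" using assms by (simp add: tw_term_def)
    have "steps (shift_term g) = []" if "steps g = []" for g
      using that by (induction g) auto
    with t show "steps (face_term 1 (shift_term f)) = []"
      by (simp add: face_term_shift_term(2)[OF t, of 0, simplified] steps_face_term_only_letter)
    have "face_word (Suc 0) (map Suc w) = []" if "set w \<subseteq> {0}" for w
      using that by (induction w) auto
    then have "face_word (Suc 0) (map Suc (src f)) = []" using wf_term_words[OF t] by simp
    then show "src (face_term 1 (shift_term f)) = []"
      using shift_term_typed[OF t] face_term_typed[of 1 0 "shift_term f"] by simp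
  qed
  show "(face_term 1 (cone_term n 0 f), mult_all n) \<in> bcong 0"
    using tw_term_face[OF tw_term_cone[OF assms], of 1] tw_term_mult_all[of n] s f
    by (intro tw_term_bcong_slidesI[of 0 n]) (simp_all add: cone_term_def face_mult_all(1)[of 0, simplified])
qed

lemma degen_Suc_cone:
  assumes "tw_term k n f" "i \<le> k"
  shows "(degen_term (Suc i) (cone_term n k f), cone_term n (Suc k) (degen_term i f)) \<in> bcong (Suc (Suc k))"
proof (rule tw_term_bcong_slidesI[of "Suc (Suc k)" n])
  have s: "steps (degen_term (Suc i) (sift (bracket_pow (Suc k) n))) \<asymp> steps (sift (bracket_pow (Suc (Suc k)) n))"
    using steps_degen_sift[of i "bracket_pow (Suc k) n"] assms(2) by (simp add: degen_word_bracket_pow)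
  show "steps (degen_term (Suc i) (cone_term n k f)) \<asymp> steps (cone_term n (Suc k) (degen_term i f))"
    using slides_append[OF s, of "[]" "steps (mult_all n \<parallel> shift_term (degen_term i f))"]
    by (simp add: cone_term_def degen_mult_all degen_term_shift_term)
qed (use assms in \<open>simp_all add: tw_term_cone tw_term_degen\<close>)

definition tw_cone :: "nat \<Rightarrow> nat \<Rightarrow> bmor \<Rightarrow> bmor" where
  "tw_cone n k F = (\<Union>f\<in>F. bmor_of (Suc k) (cone_term n k f))"

lemma tw_cone_bmor_of:
  assumes "tw_term k n f"
  shows "tw_cone n k (bmor_of k f) = bmor_of (Suc k) (cone_term n k f)"
proof -
  have eq: "bmor_of (Suc k) (cone_term n k f') = bmor_of (Suc k) (cone_term n k f)"
    if "f' \<in> bmor_of k f" for f'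
  proof -
    have ff: "(f, f') \<in> bcong k" using that by (simp add: bmor_of_def)
    have "(cone_term n k f, cone_term n k f') \<in> bcong (Suc k)"
      unfolding cone_term_def
      using assms sift_bracket_pow_typed[of k n] mult_all_typed[of "Suc k" n] shift_term_typed[of k f]
      by (intro bcong.Comp_cong bcong.Tens_cong bcong.refl shift_term_bcong[OF ff])
        (simp_all add: tw_term_def)
    then show ?thesis by (rule bmor_of_eqI[symmetric])
  qed
  have "f \<in> bmor_of k f"
    using assms by (simp add: bmor_of_def bcong.refl tw_term_def)
  with eq show ?thesis
    unfolding tw_cone_def by blast
qed

section \<open>Contractible spaces have trivial homotopy groups\<close>

definition ndisc :: "nat \<Rightarrow> (nat \<Rightarrow> real) set" where
  "ndisc n = {x. (\<Sum>i\<le>n. (x i)\<^sup>2) \<le> 1 \<and> (\<forall>i>n. x i = 0)}"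

lemma compact_space_nsphere: "compact_space (nsphere n)"
proof -
  let ?X = "powertop_real (UNIV :: nat set)" and ?S = "{x::nat \<Rightarrow> real. (\<Sum>i\<le>n. (x i)\<^sup>2) = 1 \<and> (\<forall>i>n. x i = 0)}"
  have "compactin ?X ?S"
  proof (rule closed_compactin)
    show "compactin ?X (UNIV \<rightarrow>\<^sub>E {-1..1})"
      by (simp add: compactin_PiE)
    show "?S \<subseteq> UNIV \<rightarrow>\<^sub>E {-1..1}"
    proof
      fix x assume "x \<in> ?S"
      then have "x \<in> topspace (nsphere n)" by (simp add: nsphere)
      then have "(x k)\<^sup>2 \<le> 1" for k by (rule topspace_nsphere_1)
      then have "\<bar>x k\<bar> \<le> 1" for k by (simp add: abs_square_le_1)
      then show "x \<in> UNIV \<rightarrow>\<^sub>E {-1..1}" by (auto simp: abs_le_iff minus_le_iff)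
    qed
    have eq: "?S = (\<Inter>i \<in> {n<..}. {x \<in> topspace ?X. x i \<in> {0}}) \<inter>
        {x \<in> topspace ?X. (\<Sum>i\<le>n. (x i)\<^sup>2) \<in> {1}}"
      by auto
    show "closedin ?X ?S"
      unfolding eq
      by (rule closedin_Int closedin_Inter continuous_map_sum continuous_map_real_pow
           continuous_map_product_projection closedin_continuous_map_preimage | force | clarify)+
  qed
  then show ?thesis
    by (simp add: nsphere compact_space_subtopology)
qed

lemma sum_squares_scale:
  fixes x :: "nat \<Rightarrow> real"
  shows "(\<Sum>i\<le>n. (c * x i)\<^sup>2) = c\<^sup>2 * (\<Sum>i\<le>n. (x i)\<^sup>2)"
  by (simp add: power_mult_distrib sum_distrib_left)

text \<open>
  The disc is the cone on the sphere: the parameter \<open>s\<close> shrinks the sphere to the centre.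
\<close>

lemma quotient_map_disc:
  "quotient_map (prod_topology (top_of_set {0..1}) (nsphere n)) (subtopology (powertop_real UNIV) (ndisc n))
    (\<lambda>(s, x) i. (1 - s) * x i)"
proof (rule continuous_imp_quotient_map)
  have "continuous_map (prod_topology (top_of_set {0..1}) (nsphere n)) (powertop_real UNIV)
      (\<lambda>p i. (1 - fst p) * snd p i)"
    unfolding continuous_map_componentwise_UNIV
    by (intro allI continuous_map_real_mult continuous_map_diff continuous_map_canonical_const
          continuous_map_into_fulltopology[OF continuous_map_fst]
          continuous_map_compose[OF continuous_map_snd continuous_map_nsphere_projection, unfolded comp_def])
  then show "continuous_map (prod_topology (top_of_set {0..1}) (nsphere n))
      (subtopology (powertop_real UNIV) (ndisc n)) (\<lambda>(s, x) i. (1 - s) * x i)"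
    by (auto simp: continuous_map_in_subtopology case_prod_unfold nsphere ndisc_def sum_squares_scale
        power_le_one)
  show "compact_space (prod_topology (top_of_set {0..1::real}) (nsphere n))"
    by (simp add: compact_space_prod_topology compact_space_nsphere compact_space_subtopology)
  show "Hausdorff_space (subtopology (powertop_real UNIV) (ndisc n))"
    by (simp add: Hausdorff_space_subtopology Hausdorff_space_product_topology)
  show "(\<lambda>(s, x) i. (1 - s) * x i) ` topspace (prod_topology (top_of_set {0..1}) (nsphere n)) =
      topspace (subtopology (powertop_real UNIV) (ndisc n))" (is "?q ` ?A = ?B")
  proof
    show "?q ` ?A \<subseteq> ?B"
      by (auto simp: nsphere ndisc_def sum_squares_scale power_le_one)
    show "?B \<subseteq> ?q ` ?A"
    proof
      fix y assume "y \<in> ?B"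
      then have y: "(\<Sum>i\<le>n. (y i)\<^sup>2) \<le> 1" "\<forall>i>n. y i = 0" by (auto simp: ndisc_def)
      define r where "r = sqrt (\<Sum>i\<le>n. (y i)\<^sup>2)"
      have r: "0 \<le> r" "r \<le> 1" "r\<^sup>2 = (\<Sum>i\<le>n. (y i)\<^sup>2)" using y by (auto simp: r_def sum_nonneg)
      show "y \<in> ?q ` ?A"
      proof (cases "r = 0")
        case True
        then have "(\<Sum>i\<le>n. (y i)\<^sup>2) = 0" using r by simp
        then have "\<forall>i\<le>n. y i = 0" by (subst (asm) sum_nonneg_eq_0_iff) auto
        with y have "y = ?q (1, \<lambda>i. if i = 0 then 1 else 0)" by (auto simp: not_le[symmetric])
        then show ?thesis using in_topspace_nsphere[of n]
          by (intro image_eqI[of _ _ "(1, \<lambda>i. if i = 0 then 1 else 0)"]) auto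
      next
        case False
        then have "(\<Sum>i\<le>n. (y i)\<^sup>2) \<noteq> 0" using r by (metis power_eq_0_iff)
        then have "(\<Sum>i\<le>n. (y i / r)\<^sup>2) = 1"
          using sum_squares_scale[of "1 / r" y n] False r by (simp add: power_divide)
        then have "(\<lambda>i. y i / r) \<in> topspace (nsphere n)" using y by (simp add: nsphere)
        moreover have "y = ?q (1 - r, \<lambda>i. y i / r)" using False by auto
        ultimately show ?thesis using r by (intro image_eqI[of _ _ "(1 - r, \<lambda>i. y i / r)"]) auto
      qed
    qed
  qed
qed

lemma ndisc_convex:
  assumes "x \<in> ndisc n" "y \<in> ndisc n" "0 \<le> s" "s \<le> 1"
  shows "(\<lambda>i. (1 - s) * x i + s * y i) \<in> ndisc n"
proof -
  \<comment> \<open>The square is a convex function.\<close>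
  have sq: "((1 - s) * a + s * b)\<^sup>2 \<le> (1 - s) * a\<^sup>2 + s * b\<^sup>2" for a b :: real
  proof -
    have "(1 - s) * a\<^sup>2 + s * b\<^sup>2 - ((1 - s) * a + s * b)\<^sup>2 = s * (1 - s) * (a - b)\<^sup>2"
      by (simp add: power2_eq_square algebra_simps)
    moreover have "0 \<le> s * (1 - s) * (a - b)\<^sup>2" using assms by simp
    ultimately show ?thesis by linarith
  qed
  have "(\<Sum>i\<le>n. ((1 - s) * x i + s * y i)\<^sup>2) \<le> (\<Sum>i\<le>n. (1 - s) * (x i)\<^sup>2 + s * (y i)\<^sup>2)"
    by (intro sum_mono sq)
  also have "\<dots> = (1 - s) * (\<Sum>i\<le>n. (x i)\<^sup>2) + s * (\<Sum>i\<le>n. (y i)\<^sup>2)"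
    by (simp add: sum.distrib sum_distrib_left)
  also have "\<dots> \<le> (1 - s) * 1 + s * 1"
    using assms by (intro add_mono mult_left_mono) (auto simp: ndisc_def)
  finally show ?thesis using assms by (auto simp: ndisc_def)
qed

text \<open>
  A contraction of \<open>Y\<close> gives a null homotopy of \<open>f\<close> that may move the base point. It is the same
  as an extension \<open>F\<close> of \<open>f\<close> to the disc, and contracting the disc linearly to the base point \<open>e\<close> of
  the sphere, instead of to its centre, gives a homotopy that fixes \<open>e\<close>.
\<close>

lemma contractible_imp_trivial_homotopy_group:
  assumes "contractible_space Y"
  shows "trivial_homotopy_group n Y y"
  unfolding trivial_homotopy_group_def Let_def
proof (intro allI impI, elim conjE)
  define e where "e = (\<lambda>j::nat. if j = 0 then 1 else 0 :: real)"
  fix f assume f: "continuous_map (nsphere n) Y f" and "f (\<lambda>j. if j = 0 then 1 else 0) = y"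
  then have fe: "f e = y" by (simp add: e_def)
  let ?I = "top_of_set {0..1::real}"
  let ?D = "subtopology (powertop_real UNIV) (ndisc n)"
  let ?q = "\<lambda>(s::real, x::nat \<Rightarrow> real) i. (1 - s) * x i"
  have e: "e \<in> topspace (nsphere n)" using in_topspace_nsphere by (simp add: e_def)
  obtain a h where h: "continuous_map (prod_topology ?I Y) Y h"
    and h0: "\<And>x. h (0, x) = x" and h1: "\<And>x. h (1, x) = a"
    using assms by (auto simp: contractible_space_def homotopic_with_def)
  have g: "continuous_map (prod_topology ?I (nsphere n)) Y (\<lambda>p. h (fst p, f (snd p)))"
    by (intro continuous_map_compose[OF _ h, unfolded comp_def] continuous_map_pairedI
        continuous_map_fst continuous_map_compose[OF continuous_map_snd f, unfolded comp_def])
  \<comment> \<open>The norm determines \<open>s\<close>; for \<open>s < 1\<close> also the direction is determined, and at the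
    centre \<open>h\<close> is constant.\<close>
  have well_defined: "h (fst p, f (snd p)) = h (fst p', f (snd p'))"
    if "p \<in> topspace (prod_topology ?I (nsphere n))" "p' \<in> topspace (prod_topology ?I (nsphere n))"
      and eq: "?q p = ?q p'" for p p'
  proof -
    obtain s x s' x' where p: "p = (s, x)" "p' = (s', x')" by (cases p; cases p')
    have s: "s \<le> 1" "s' \<le> 1" and x: "(\<Sum>i\<le>n. (x i)\<^sup>2) = 1" "(\<Sum>i\<le>n. (x' i)\<^sup>2) = 1"
      using that by (auto simp: p nsphere)
    have eq': "(1 - s) * x i = (1 - s') * x' i" for i
      using fun_cong[OF eq, of i] by (simp add: p)
    then have "(1 - s)\<^sup>2 = (1 - s')\<^sup>2"
      using sum_squares_scale[of "1 - s" x n] sum_squares_scale[of "1 - s'" x' n] x by simp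
    then have ss: "s = s'" using s by (simp add: power2_eq_iff_nonneg)
    show ?thesis
    proof (cases "s = 1")
      case False
      then have "x = x'" using eq' ss by auto
      then show ?thesis by (simp add: p ss)
    qed (simp add: p ss[symmetric] h1)
  qed
  obtain F where F: "continuous_map ?D Y F"
    and Fq: "\<And>p. p \<in> topspace (prod_topology ?I (nsphere n)) \<Longrightarrow> F (?q p) = h (fst p, f (snd p))"
    by (rule quotient_map_lift_exists[OF quotient_map_disc g]) (assumption | rule well_defined that)+
  have Ff: "F x = f x" if "x \<in> topspace (nsphere n)" for x
    using Fq[of "(0, x)"] that by (simp add: h0)
  have in_disc: "(\<lambda>i. (1 - s) * x i + s * e i) \<in> ndisc n"
    if "x \<in> topspace (nsphere n)" "s \<in> {0..1}" for x s
    using that e by (intro ndisc_convex) (auto simp: nsphere ndisc_def)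
  have "continuous_map (prod_topology ?I (nsphere n)) (powertop_real UNIV)
      (\<lambda>p i. (1 - fst p) * snd p i + fst p * e i)"
    unfolding continuous_map_componentwise_UNIV
    by (intro allI continuous_map_add continuous_map_real_mult continuous_map_diff
          continuous_map_canonical_const continuous_map_into_fulltopology[OF continuous_map_fst]
          continuous_map_compose[OF continuous_map_snd continuous_map_nsphere_projection, unfolded comp_def])
  then have "continuous_map (prod_topology ?I (nsphere n)) ?D (\<lambda>p i. (1 - fst p) * snd p i + fst p * e i)"
    using in_disc by (auto simp: continuous_map_in_subtopology)
  then have K: "continuous_map (prod_topology ?I (nsphere n)) Y
      (\<lambda>p. F (\<lambda>i. (1 - fst p) * snd p i + fst p * e i))"
    by (rule continuous_map_compose[OF _ F, unfolded comp_def])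
  have "homotopic_with (\<lambda>h. h e = y) (nsphere n) Y f (\<lambda>_. y)"
  proof (subst homotopic_with)
    show "(h e = y) = (k e = y)" if "\<And>x. x \<in> topspace (nsphere n) \<Longrightarrow> h x = k x" for h k
      using that e by simp
    have "(\<lambda>i. (1 - s) * e i + s * e i) = e" for s :: real
      by (auto simp: algebra_simps)
    then show "\<exists>h. continuous_map (prod_topology ?I (nsphere n)) Y h \<and>
        (\<forall>x\<in>topspace (nsphere n). h (0, x) = f x) \<and>
        (\<forall>x\<in>topspace (nsphere n). h (1, x) = y) \<and> (\<forall>t\<in>{0..1}. h (t, e) = y)"
      using K Ff e fe by (intro exI[of _ "\<lambda>p. F (\<lambda>i. (1 - fst p) * snd p i + fst p * e i)"]) auto
  qed
  then show "homotopic_with (\<lambda>h. h (\<lambda>j. if j = 0 then 1 else 0) = y) (nsphere n) Y f (\<lambda>_. y)"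
    by (simp add: e_def)
qed

section \<open>Extra degeneracies contract the realization\<close>

text \<open>
  The point that divides the segment from \<open>t\<close>, in the face opposite to the vertex \<open>0\<close>, to that vertex
  in the ratio \<open>s : 1 - s\<close>.
\<close>

definition cone_point :: "real \<Rightarrow> (nat \<Rightarrow> real) \<Rightarrow> nat \<Rightarrow> real" where
  "cone_point s t = (\<lambda>j. if j = 0 then s else (1 - s) * t (j - 1))"

lemma cone_point_in_standard_simplex:
  assumes "s \<in> {0..1}" "t \<in> standard_simplex k"
  shows "cone_point s t \<in> standard_simplex (Suc k)"
proof -
  have "(\<Sum>j\<le>Suc k. cone_point s t j) = s + (1 - s) * (\<Sum>j\<le>k. t j)"
    by (simp add: sum.atMost_Suc_shift cone_point_def sum_distrib_left del: sum.atMost_Suc)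
  moreover have "(1 - s) * t j \<le> 1" for j
    using assms by (intro mult_le_one) (auto simp: standard_simplex_def)
  ultimately show ?thesis
    using assms by (auto simp: standard_simplex_def cone_point_def)
qed

lemma cone_point_0: "cone_point 0 t = simplical_face 0 t"
  by (auto simp: cone_point_def simplical_face_def)

lemma cone_point_1: "cone_point 1 t = (\<lambda>j. if j = 0 then 1 else 0)"
  by (auto simp: cone_point_def)

lemma simplical_face_cone_point:
  "simplical_face (Suc i) (cone_point s t) = cone_point s (simplical_face i t)"
  by (rule ext) (auto simp: cone_point_def simplical_face_def)

lemma simplical_degen_cone_point:
  "simplical_degen (Suc i) (cone_point s t) = cone_point s (simplical_degen i t)"
  by (rule ext) (auto simp: cone_point_def simplical_degen_def algebra_simps)

lemma continuous_map_from_sum_topology: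
  assumes "\<And>i. i \<in> I \<Longrightarrow> continuous_map (X i) Y (\<lambda>x. f (i, x))"
  shows "continuous_map (sum_topology X I) Y f"
  unfolding continuous_map_def
proof (intro conjI allI impI)
  show "f \<in> topspace (sum_topology X I) \<rightarrow> topspace Y"
    using assms continuous_map_image_subset_topspace by fastforce
  fix U assume U: "openin Y U"
  have "openin (X i) {x. (i, x) \<in> {p \<in> topspace (sum_topology X I). f p \<in> U}}" if "i \<in> I" for i
    using openin_continuous_map_preimage[OF assms[OF that] U] that by simp
  then show "openin (sum_topology X I) {p \<in> topspace (sum_topology X I). f p \<in> U}"
    unfolding openin_sum_topology by auto
qed

lemma topspace_cells: "topspace (cells X) = (SIGMA c:Sigma UNIV (simplices X). standard_simplex (fst c))"
  by (auto simp: cells_def)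

text \<open>
  The extra degeneracy \<open>e\<close> behaves like \<open>s_{-1}\<close>, and \<open>v\<close> is the vertex at which all cones have
  their apex.
\<close>

locale extra_degeneracy = simplicial_set X for X :: "'a sset" +
  fixes e :: "nat \<Rightarrow> 'a \<Rightarrow> 'a" and v :: 'a
  assumes extra_closed: "x \<in> simplices X k \<Longrightarrow> e k x \<in> simplices X (Suc k)"
    and vertex: "v \<in> simplices X 0"
    and face_0_extra: "x \<in> simplices X k \<Longrightarrow> face X (Suc k) 0 (e k x) = x"
    and face_Suc_extra: "\<lbrakk>x \<in> simplices X (Suc k); i \<le> Suc k\<rbrakk> \<Longrightarrow>
        face X (Suc (Suc k)) (Suc i) (e (Suc k) x) = e k (face X (Suc k) i x)"
    and face_1_extra: "x \<in> simplices X 0 \<Longrightarrow> face X (Suc 0) (Suc 0) (e 0 x) = v"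
    and degen_Suc_extra: "\<lbrakk>x \<in> simplices X k; i \<le> k\<rbrakk> \<Longrightarrow>
        degen X (Suc k) (Suc i) (e k x) = e (Suc k) (degen X k i x)"
begin

definition cone_cell :: "real \<times> (nat \<times> 'a) \<times> (nat \<Rightarrow> real) \<Rightarrow> (nat \<times> 'a) \<times> (nat \<Rightarrow> real)" where
  "cone_cell = (\<lambda>(s, (k, x), t). ((Suc k, e k x), cone_point s t))"

lemma cone_cell_glue:
  assumes "glue X p p'" "s \<in> {0..1}"
  shows "glue X (cone_cell (s, p)) (cone_cell (s, p'))"
  using assms(1)
proof cases
  case (glue_face x k i t)
  have "glue X ((Suc k, face X (Suc (Suc k)) (Suc i) (e (Suc k) x)), cone_point s t)
      ((Suc (Suc k), e (Suc k) x), simplical_face (Suc i) (cone_point s t))"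
    using glue_face assms(2) by (intro glue.glue_face extra_closed cone_point_in_standard_simplex) auto
  then show ?thesis
    using glue_face by (simp add: cone_cell_def face_Suc_extra simplical_face_cone_point)
next
  case (glue_degen x k i t)
  have "glue X ((Suc (Suc k), degen X (Suc k) (Suc i) (e k x)), cone_point s t)
      ((Suc k, e k x), simplical_degen (Suc i) (cone_point s t))"
    using glue_degen assms(2) by (intro glue.glue_degen extra_closed cone_point_in_standard_simplex) auto
  then show ?thesis
    using glue_degen by (simp add: cone_cell_def degen_Suc_extra simplical_degen_cone_point)
qed

lemma cone_cell_equiv:
  assumes "equivclp (glue X) p p'" "s \<in> {0..1}"
  shows "equivclp (glue X) (cone_cell (s, p)) (cone_cell (s, p'))"
  using assms(1)
proof (induction rule: equivclp_induct)
  case (step y z)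
  with cone_cell_glue[OF _ assms(2)] have "glue X (cone_cell (s, y)) (cone_cell (s, z)) \<or>
      glue X (cone_cell (s, z)) (cone_cell (s, y))"
    by blast
  with step.IH show ?case by (rule equivclp_into_equivclp)
qed simp

lemma cone_cell_0:
  assumes "p \<in> topspace (cells X)"
  shows "equivclp (glue X) p (cone_cell (0, p))"
proof -
  obtain k x t where p: "p = ((k, x), t)" "x \<in> simplices X k" "t \<in> standard_simplex k"
    using assms by (auto simp: topspace_cells)
  have "glue X ((k, face X (Suc k) 0 (e k x)), t) ((Suc k, e k x), simplical_face 0 t)"
    using p by (intro glue.glue_face extra_closed) auto
  then show ?thesis
    using p by (simp add: cone_cell_def face_0_extra cone_point_0 r_into_equivclp)
qed

text \<open>
  All apexes are glued to \<open>v\<close>: the face \<open>d_1\<close> contains the vertex \<open>0\<close> and turns a cone over a simplex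
  into the cone over one of its faces, so the dimension descends until the simplex is a vertex.
\<close>

lemma cone_apex_equiv:
  assumes "x \<in> simplices X k"
  defines "z \<equiv> (\<lambda>j. if j = 0 then 1 else 0) :: nat \<Rightarrow> real"
  shows "equivclp (glue X) ((Suc k, e k x), z) ((0, v), z)"
  using assms(1)
proof (induction k arbitrary: x)
  case 0
  have z: "simplical_face (Suc 0) z = z" by (auto simp: z_def simplical_face_def)
  have "glue X ((0, face X (Suc 0) (Suc 0) (e 0 x)), z) ((Suc 0, e 0 x), simplical_face (Suc 0) z)"
    using 0 by (intro glue.glue_face extra_closed) (auto simp: z_def)
  then show ?case
    using 0 by (simp add: face_1_extra z converse_r_into_equivclp)
next
  case (Suc k)
  have z: "simplical_face (Suc 0) z = z" by (auto simp: z_def simplical_face_def)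
  have "glue X ((Suc k, face X (Suc (Suc k)) (Suc 0) (e (Suc k) x)), z)
      ((Suc (Suc k), e (Suc k) x), simplical_face (Suc 0) z)"
    using Suc.prems by (intro glue.glue_face extra_closed) (auto simp: z_def)
  then have "equivclp (glue X) ((Suc (Suc k), e (Suc k) x), z) ((Suc k, e k (face X (Suc k) 0 x)), z)"
    using Suc.prems by (simp add: face_Suc_extra z converse_r_into_equivclp)
  also have "equivclp (glue X) ((Suc k, e k (face X (Suc k) 0 x)), z) ((0, v), z)"
    using Suc.prems by (intro Suc.IH face_closed) simp_all
  finally show ?case .
qed

text \<open>
  The components of the coproduct are open, so continuity can be checked on each \<open>[0, 1] \<times> \<Delta>\<^sup>k\<close>.
\<close>

lemma continuous_map_cone_cell:
  "continuous_map (prod_topology (top_of_set {0..1}) (cells X)) (cells X) cone_cell"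
proof (rule pasting_lemma[where I = "Sigma UNIV (simplices X)" and f = "\<lambda>_. cone_cell"
      and T = "\<lambda>c. {0..1} \<times> ({c} \<times> standard_simplex (fst c))"])
  let ?P = "powertop_real (UNIV :: nat set)"
  let ?S = "\<lambda>(k, x). subtopology ?P (standard_simplex k)"
  let ?I = "top_of_set {0..1::real}"
  fix c assume c: "c \<in> Sigma UNIV (simplices X)"
  obtain k x where kx: "c = (k, x)" "x \<in> simplices X k" using c by auto
  have "openin (cells X) ({c} \<times> standard_simplex (fst c))"
  proof -
    have "openin (cells X) (Pair c ` topspace (?S c))"
      using open_map_component_injection[OF c, of ?S] openin_topspace unfolding open_map_def cells_def by blast
    moreover have "Pair c ` topspace (?S c) = {c} \<times> standard_simplex (fst c)" by (auto simp: kx)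
    ultimately show ?thesis by simp
  qed
  then show "openin (prod_topology ?I (cells X)) ({0..1} \<times> ({c} \<times> standard_simplex (fst c)))"
    by (simp add: openin_prod_Times_iff)
  have snd: "continuous_map (cells X) ?P snd"
    unfolding cells_def by (rule continuous_map_from_sum_topology) (auto simp: continuous_map_from_subtopology)
  have "continuous_map (prod_topology ?I (cells X)) ?P (\<lambda>p. cone_point (fst p) (snd (snd p)))"
    unfolding continuous_map_componentwise_UNIV
  proof
    fix j
    have "continuous_map (prod_topology ?I (cells X)) ?P (\<lambda>p. snd (snd p))"
      by (rule continuous_map_compose[OF continuous_map_snd snd, unfolded comp_def])
    then have "continuous_map (prod_topology ?I (cells X)) euclideanreal (\<lambda>p. snd (snd p) (j - 1))"
      unfolding continuous_map_componentwise_UNIV by blast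
    then show "continuous_map (prod_topology ?I (cells X)) euclideanreal
        (\<lambda>p. cone_point (fst p) (snd (snd p)) j)"
      unfolding cone_point_def
      by (cases "j = 0") (auto intro!: continuous_map_real_mult continuous_map_diff
          continuous_map_into_fulltopology[OF continuous_map_fst])
  qed
  then have "continuous_map (subtopology (prod_topology ?I (cells X)) ({0..1} \<times> ({c} \<times> standard_simplex (fst c))))
      (?S (Suc k, e k x)) (\<lambda>p. cone_point (fst p) (snd (snd p)))"
    using cone_point_in_standard_simplex[of _ _ k]
    by (auto simp: continuous_map_in_subtopology kx intro: continuous_map_from_subtopology)
  moreover have "continuous_map (?S (Suc k, e k x)) (cells X) (\<lambda>t. ((Suc k, e k x), t))"
    unfolding cells_def using kx extra_closed by (intro continuous_map_component_injection) auto
  ultimately have "continuous_map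
      (subtopology (prod_topology ?I (cells X)) ({0..1} \<times> ({c} \<times> standard_simplex (fst c))))
      (cells X) (\<lambda>p. ((Suc k, e k x), cone_point (fst p) (snd (snd p))))"
    by (rule continuous_map_compose[unfolded comp_def])
  then show "continuous_map
      (subtopology (prod_topology ?I (cells X)) ({0..1} \<times> ({c} \<times> standard_simplex (fst c))))
      (cells X) cone_cell"
    by (rule continuous_map_eq) (auto simp: cone_cell_def kx)
qed (auto simp: topspace_cells)

text \<open>
  The homotopy is defined on cells and descends to the realization because \<open>[0, 1]\<close> is locally
  compact Hausdorff, whence the product of the projection with \<open>[0, 1]\<close> is again a quotient map.
\<close>

theorem contractible_space_realization: "contractible_space (realization X)"
proof -
  let ?I = "top_of_set {0..1::real}"
  let ?q = "\<lambda>p. {p'. equivclp (glue X) p p'}"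
  let ?z = "(\<lambda>j. if j = 0 then 1 else 0) :: nat \<Rightarrow> real"
  have q_eq: "?q p = ?q p' \<longleftrightarrow> equivclp (glue X) p p'" for p p'
    by (auto intro: equivclp_trans equivclp_sym)
  have q: "quotient_map (cells X) (realization X) ?q"
    unfolding realization_def by (rule quotient_map_quotient_topology)
  have "compact_space ?I" by (simp add: compact_space_subtopology)
  then have Q: "quotient_map (prod_topology ?I (cells X)) (prod_topology ?I (realization X)) (\<lambda>(s, p). (s, ?q p))"
    by (intro quotient_map_prod_right[OF _ _ q] compact_imp_locally_compact_space)
      (simp_all add: Hausdorff_space_subtopology)
  have h: "continuous_map (prod_topology ?I (cells X)) (realization X) (\<lambda>a. ?q (cone_cell a))"
    using continuous_map_compose[OF continuous_map_cone_cell quotient_imp_continuous_map[OF q]]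
    by (simp add: comp_def)
  have compat: "?q (cone_cell a) = ?q (cone_cell b)"
    if "a \<in> topspace (prod_topology ?I (cells X))" "b \<in> topspace (prod_topology ?I (cells X))"
      and "(\<lambda>(s, p). (s, ?q p)) a = (\<lambda>(s, p). (s, ?q p)) b" for a b
  proof -
    obtain s p s' p' where ab: "a = (s, p)" "b = (s', p')" by (cases a; cases b)
    have "s = s'" "?q p = ?q p'" "s \<in> {0..1}" using that by (simp_all add: ab)
    then show ?thesis using cone_cell_equiv unfolding ab q_eq by blast
  qed
  obtain H where H: "continuous_map (prod_topology ?I (realization X)) (realization X) H"
    and Hq: "\<And>a. a \<in> topspace (prod_topology ?I (cells X)) \<Longrightarrow> H ((\<lambda>(s, p). (s, ?q p)) a) = ?q (cone_cell a)"
    by (rule quotient_map_lift_exists[OF Q h]) (assumption | rule compat that)+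
  have top: "topspace (realization X) = ?q ` topspace (cells X)"
    using quotient_imp_surjective_map[OF q] by simp
  have H0: "H (0, y) = y" and H1: "H (1, y) = ?q ((0, v), ?z)" if y: "y \<in> topspace (realization X)" for y
  proof -
    obtain p where p: "p \<in> topspace (cells X)" "y = ?q p" using y top by auto
    obtain k x t where kxt: "p = ((k, x), t)" "x \<in> simplices X k" using p by (auto simp: topspace_cells)
    show "H (0, y) = y"
      using Hq[of "(0, p)"] p equivclp_sym[OF cone_cell_0[OF p(1)]] q_eq by simp
    have "?q (cone_cell (1, p)) = ?q ((0, v), ?z)"
      unfolding q_eq using cone_apex_equiv[OF kxt(2)] by (simp add: cone_cell_def kxt cone_point_1)
    then show "H (1, y) = ?q ((0, v), ?z)"
      using Hq[of "(1, p)"] p by simp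
  qed
  have "homotopic_with (\<lambda>_. True) (realization X) (realization X) id (\<lambda>_. ?q ((0, v), ?z))"
    by (subst homotopic_with) (use H H0 H1 in auto)
  then show ?thesis
    unfolding contractible_space_def by blast
qed

lemma topspace_realization_nonempty: "topspace (realization X) \<noteq> {}"
proof -
  have "((0, v), \<lambda>j. if j = 0 then 1 else 0) \<in> topspace (cells X)"
    using vertex by (simp add: topspace_cells)
  then show ?thesis
    by (auto simp: realization_def topspace_quotient_topology)
qed

end

section \<open>Weak contractibility of TW\<close>

lemma extra_degeneracy_TW: "extra_degeneracy (TW n) (tw_cone n) (bmor_of 0 (mult_all n))"
proof (intro extra_degeneracy.intro simplicial_set_TW extra_degeneracy_axioms.intro)
  fix x k assume "x \<in> simplices (TW n) k"
  then obtain f where x: "x = bmor_of k f" and f: "tw_term k n f" by auto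
  show "tw_cone n k x \<in> simplices (TW n) (Suc k)"
    using f tw_term_cone by (auto simp: x tw_cone_bmor_of)
  show "face (TW n) (Suc k) 0 (tw_cone n k x) = x"
    using f tw_term_cone[OF f] bmor_of_eqI[OF face_zero_cone[OF f]] by (simp add: x tw_cone_bmor_of)
  show "degen (TW n) (Suc k) (Suc i) (tw_cone n k x) = tw_cone n (Suc k) (degen (TW n) k i x)"
    if "i \<le> k" for i
    using that f tw_term_cone[OF f] tw_term_degen[OF f that] bmor_of_eqI[OF degen_Suc_cone[OF f that]]
    by (simp add: x tw_cone_bmor_of)
next
  fix x k i assume "x \<in> simplices (TW n) (Suc k)" and i: "i \<le> Suc k"
  then obtain f where x: "x = bmor_of (Suc k) f" and f: "tw_term (Suc k) n f" by auto
  show "face (TW n) (Suc (Suc k)) (Suc i) (tw_cone n (Suc k) x) = tw_cone n k (face (TW n) (Suc k) i x)"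
    using i f tw_term_cone[OF f] tw_term_face[OF f i] bmor_of_eqI[OF face_Suc_cone[OF f i]]
    by (simp add: x tw_cone_bmor_of)
next
  show "bmor_of 0 (mult_all n) \<in> simplices (TW n) 0"
    using tw_term_mult_all by simp
  fix x assume "x \<in> simplices (TW n) 0"
  then obtain f where x: "x = bmor_of 0 f" and f: "tw_term 0 n f" by auto
  show "face (TW n) (Suc 0) (Suc 0) (tw_cone n 0 x) = bmor_of 0 (mult_all n)"
    using f tw_term_cone[OF f] bmor_of_eqI[OF face_one_cone_vertex[OF f]] by (simp add: x tw_cone_bmor_of)
qed

lemma weakly_contractible_TW: "weakly_contractible (TW n)"
proof -
  interpret extra_degeneracy "TW n" "tw_cone n" "bmor_of 0 (mult_all n)"
    by (rule extra_degeneracy_TW)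
  show ?thesis
    unfolding weakly_contractible_def weakly_contractible_space_def
    using topspace_realization_nonempty
      contractible_imp_trivial_homotopy_group[OF contractible_space_realization] by blast
qed

theorem theorem2p11:
  shows "A_infinity_operad TW TW_comp TW_unit"
  using ns_operad_TW weakly_contractible_TW by (simp add: A_infinity_operad_def)

end
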